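(* Let $k\ge 1$ and let $i_1,\dots,i_k\ge 1$ be integers. In the polynomial ring in commuting variables $x_1,x_{1.5},x_2,x_{2.5},\dots,x_{k-0.5},x_k$ write $$\prod_{j=1}^{k-1}(x_j+x_{j+0.5}+x_{j+1})=\sum_{\alpha}c_\alpha\, x_1^{\alpha_1}x_{1.5}^{\alpha_{1.5}}x_2^{\alpha_2}\cdots x_{k-0.5}^{\alpha_{k-0.5}}x_k^{\alpha_k},$$ where $\alpha=(\alpha_1,\alpha_{1.5},\alpha_2,\dots,\alpha_{k-0.5},\alpha_k)$ runs over the exponent vectors of the monomials occurring in the product and $c_\alpha$ is the corresponding coefficient. For each such $\alpha$ let $$GZ[\alpha,i]=GZ\bigl(1^{i_1-1+\alpha_1}\,1.5^{\alpha_{1.5}}\,2^{i_2-1+\alpha_2}\,2.5^{\alpha_{2.5}}\cdots (k-0.5)^{\alpha_{k-0.5}}\,k^{i_k-1+\alpha_k}\bigr),$$ and let $\dim(A_\alpha)=\alpha_{1.5}+\alpha_{2.5}+\dots+\alpha_{k-0.5}$. Then $$f_{GZ(1^{i_1}\cdots k^{i_k})}(t)=\sum_{\alpha}c_\alpha\cdot t^{\dim(A_\alpha)}\cdot f_{GZ[\alpha,i]}(t).$$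
   Context: Gelfand–Zetlin polytope: for real numbers $\lambda_1\le\dots\le\lambda_s$, $GZ(\lambda_1\dots\lambda_s)\subset\mathbb{R}^{s(s-1)/2}$ is the convex polytope of all points with coordinates $u_{i,j}$ ($1\le i\le s-1$, $1\le j\le s-i$) satisfying $u_{i-1,j}\le u_{i,j}\le u_{i-1,j+1}$ for all such $i,j$, where $u_{0,j}:=\lambda_j$. For $s\le 1$ it is the single point $\mathbb{R}^0$. Multiplicative notation is used for repetitions: $GZ(a_1^{m_1}\cdots a_r^{m_r})$ with $a_1<\dots<a_r$ and integers $m_q\ge 0$ is the polytope of the nondecreasing sequence in which $a_q$ is repeated $m_q$ times. For a polytope $P$ of dimension $n$, the $f$-polynomial is $f_P(t)=\sum_{d=0}^n f_d t^d$, where $f_d$ is the number of $d$-dimensional faces of $P$ (nonempty faces, $P$ itself included, so $f_n=1$). The notation $A_\alpha$ refers to a face of the cube $C=\{(u_1,\dots,u_{k-1}) : j\le u_j\le j+1\}\subset\mathbb{R}^{k-1}$. Choosing the summand $x_j$, $x_{j+0.5}$ or $x_{j+1}$ in the $j$-th factor corresponds to the face whose barycenter has $u_j=j$, $j+0.5$ or $j+1$ respectively, and $\dim A_\alpha$ is the dimension of any face whose monomial has exponent $\alpha$, i.e. the total exponent of the variables with half-integer index. *)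

theory Defs
  imports
    "HOL-Analysis.Analysis"
    "HOL-Analysis.Finite_Function_Topology"
    "HOL-Computational_Algebra.Polynomial"
begin

text \<open>
  The number of coordinates of a Gelfand--Zetlin polytope depends on its defining sequence, and
  polytopes with different numbers of coordinates occur together. So all of them live in the one
  real vector space of finitely supported functions on pairs of naturals, and
  \<open>\<real>\<^bsup>s(s-1)/2\<^esup>\<close> is its subspace of the functions supported on the index set \<open>gz_index s\<close>.
\<close>

definition gz_index :: "nat \<Rightarrow> (nat \<times> nat) set" where
  "gz_index s = {(i, j). 1 \<le> i \<and> i \<le> s - 1 \<and> 1 \<le> j \<and> j \<le> s - i}"

definition gz_coord :: "real list \<Rightarrow> ((nat \<times> nat) \<Rightarrow>\<^sub>0 real) \<Rightarrow> nat \<Rightarrow> nat \<Rightarrow> real" where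
  "gz_coord ls u i j = (if i = 0 then ls ! (j - 1) else Poly_Mapping.lookup u (i, j))"

text \<open>Meant for nondecreasing lists.\<close>

definition GZ :: "real list \<Rightarrow> ((nat \<times> nat) \<Rightarrow>\<^sub>0 real) set" where
  "GZ ls = {u. Poly_Mapping.keys u \<subseteq> gz_index (length ls) \<and>
     (\<forall>(i, j) \<in> gz_index (length ls).
        gz_coord ls u (i - 1) j \<le> gz_coord ls u i j \<and>
        gz_coord ls u i j \<le> gz_coord ls u (i - 1) (j + 1))}"

text \<open>
  \<open>GZ_mult [(a\<^sub>1, m\<^sub>1), \<dots>, (a\<^sub>r, m\<^sub>r)]\<close>, with \<open>a\<^sub>1 < \<dots> < a\<^sub>r\<close>, is the polytope in multiplicative notation.
\<close>

definition GZ_mult :: "(real \<times> nat) list \<Rightarrow> ((nat \<times> nat) \<Rightarrow>\<^sub>0 real) set" where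
  "GZ_mult ps = GZ (concat (map (\<lambda>(a, m). replicate m a) ps))"

text \<open>
  Dimension of the linear space parallel to the affine hull; \<open>aff_dim\<close> is only available in
  Euclidean spaces.
\<close>

definition affine_dim :: "'a::real_vector set \<Rightarrow> nat" where
  "affine_dim S = dim {x - y | x y. x \<in> S \<and> y \<in> S}"

definition f_number :: "'a::real_vector set \<Rightarrow> nat \<Rightarrow> nat" where
  "f_number P d = card {F. F face_of P \<and> F \<noteq> {} \<and> affine_dim F = d}"

definition f_poly :: "'a::real_vector set \<Rightarrow> int poly" where
  "f_poly P = (\<Sum>d = 0..affine_dim P. monom (int (f_number P d)) d)"

text \<open>
  Polynomials in variables indexed by reals; only the indices \<open>1, 1.5, 2, \<dots>, k\<close> occur.
  A monomial is its exponent vector.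
\<close>

type_synonym exponent = "real \<Rightarrow>\<^sub>0 nat"

definition xvar :: "real \<Rightarrow> exponent \<Rightarrow>\<^sub>0 int" where
  "xvar r = Poly_Mapping.single (Poly_Mapping.single r 1) 1"

definition cube_poly :: "nat \<Rightarrow> exponent \<Rightarrow>\<^sub>0 int" where
  "cube_poly k = (\<Prod>j = 1..k - 1. xvar (real j) + xvar (real j + 1/2) + xvar (real j + 1))"

definition dim_A :: "nat \<Rightarrow> exponent \<Rightarrow> nat" where
  "dim_A k \<alpha> = (\<Sum>j = 1..k - 1. Poly_Mapping.lookup \<alpha> (real j + 1/2))"

definition GZ_alpha :: "nat \<Rightarrow> (nat \<Rightarrow> nat) \<Rightarrow> exponent \<Rightarrow> ((nat \<times> nat) \<Rightarrow>\<^sub>0 real) set" where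
  "GZ_alpha k i \<alpha> = GZ_mult
     (concat (map (\<lambda>j. [(real j, i j - 1 + Poly_Mapping.lookup \<alpha> (real j)),
                        (real j + 1/2, Poly_Mapping.lookup \<alpha> (real j + 1/2))]) [1..<k])
      @ [(real k, i k - 1 + Poly_Mapping.lookup \<alpha> (real k))])"

end

(*
  A nonempty face of a polyhedron is determined by the inequalities that are tight at a relative
  interior point, and its dimension is that of the solution space of the corresponding homogeneous
  equations.  Fix a nondecreasing sequence and look at the first row of a point of its polytope.
  The row ranges over a cube, and a strictly increasing map of the real line, applied to all free
  entries, moves it to the barycenter of the cube face that contains it in its relative interior,
  without changing which inequalities are tight.  Hence the faces over a given open cube face
  correspond to the faces of the polytope of its barycenter.  The dimension grows by the number of
  entries of the barycenter that do not occur in the given sequence: such an entry occurs once, and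
  moving all coordinates that equal it is an admissible direction.
*)
theory Submission
  imports Defs
begin

section \<open>Faces of a polyhedron and sets of tight inequalities\<close>

text \<open>Transport along a strictly increasing map works because the inequalities that are tight
  between the given sequence \<open>ls\<close> and an interlacing row \<open>r\<close> already fix
  the order pattern of the row. For \<open>j < l\<close> one has \<open>r ! j\<close> <=
  \<open>ls ! Suc j\<close> <= \<open>ls ! l\<close> <= \<open>r ! l\<close>, so the two entries
  coincide only if both are tight against the same value.

  The resulting recursion holds for every nonempty nondecreasing sequence. The special sequence
  enters only in the bookkeeping. A row coordinate between two equal neighbours is forced, which
  accounts for the \<open>i j - 1\<close> fixed copies of \<open>j\<close>. The remaining
  \<open>k - 1\<close> coordinates, one between the last \<open>j\<close> and the first
  \<open>j + 1\<close>, form the cube. A barycenter is itself nondecreasing, hence determined by the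
  multiset of its entries. This is why the polytope over a cube face depends on the monomial alone,
  and why cube faces with the same monomial can be collected in a coefficient.\<close>

text \<open>Each \<open>g c\<close> is an affine functional with linear part \<open>h c\<close>; the set \<open>C\<close> need not be irredundant.\<close>

locale slack_polyhedron =
  fixes W :: "'a::real_vector set" and C :: "'c set"
    and g h :: "'c \<Rightarrow> 'a \<Rightarrow> real"
  assumes subspace_W: "subspace W"
    and W_finite_dim: "\<exists>B. finite B \<and> W \<subseteq> span B"
    and finite_C: "finite C"
    and linear_h: "\<And>c. linear (h c)"
    and g_add: "\<And>c x v. g c (x + v) = g c x + h c v"
begin

definition P :: "'a set" where
  "P = {x \<in> W. \<forall>c\<in>C. g c x \<ge> 0}"

definition T :: "'a \<Rightarrow> 'c set" where
  "T x = {c \<in> C. g c x = 0}"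

definition V :: "'c set \<Rightarrow> 'a set" where
  "V S = {v \<in> W. \<forall>c\<in>S. h c v = 0}"

definition F :: "'c set \<Rightarrow> 'a set" where
  "F S = {y \<in> P. S \<subseteq> T y}"

lemma h_scale: "h c (r *\<^sub>R v) = r * h c v"
  using linear_h[of c] by (simp add: linear_scale)

lemma g_scale: "g c (x + r *\<^sub>R v) = g c x + r * h c v"
  by (simp add: g_add h_scale)

lemma h_diff: "h c (y - x) = g c y - g c x"
  using g_add[of c x "y - x"] by simp

lemma g_convex_comb: "g c ((1 - t) *\<^sub>R x + t *\<^sub>R y) = (1 - t) * g c x + t * g c y"
proof -
  have "(1 - t) *\<^sub>R x + t *\<^sub>R y = x + t *\<^sub>R (y - x)"
    by (simp add: algebra_simps)
  then have "g c ((1 - t) *\<^sub>R x + t *\<^sub>R y) = g c x + t * (g c y - g c x)"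
    by (simp only: g_scale h_diff)
  then show ?thesis
    by (simp add: algebra_simps)
qed

lemma W_comb: "x \<in> W \<Longrightarrow> y \<in> W \<Longrightarrow> a *\<^sub>R x + b *\<^sub>R y \<in> W"
  using subspace_W by (simp add: subspace_add subspace_scale)

lemma comb_in_P: 
  assumes "x \<in> P" "y \<in> P" "0 \<le> t" "t \<le> 1"
  shows "(1 - t) *\<^sub>R x + t *\<^sub>R y \<in> P"
  using assms unfolding P_def by (auto simp: g_convex_comb W_comb)

text \<open>Slacks are affine and nonnegative on \<open>P\<close>, and a sum of two nonnegative
  numbers with positive weights vanishes only if both do. So the tight sets of points of
  \<open>P\<close> are closed under intersection.\<close>

lemma T_comb:
  assumes "x \<in> P" "y \<in> P" "0 < t" "t < 1"
  shows "T ((1 - t) *\<^sub>R x + t *\<^sub>R y) = T x \<inter> T y"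
proof -
  have "g c ((1 - t) *\<^sub>R x + t *\<^sub>R y) = 0 \<longleftrightarrow> g c x = 0 \<and> g c y = 0" if "c \<in> C" for c
  proof -
    have "g c x \<ge> 0" "g c y \<ge> 0" using assms that by (auto simp: P_def)
    then show ?thesis
      using assms by (simp add: g_convex_comb add_nonneg_eq_0_iff)
  qed
  then show ?thesis by (auto simp: T_def)
qed

text \<open>Slacks tight at \<open>x\<close> do not change along \<open>v\<close>; the others are
  positive at \<open>x\<close> and finite in number, so a small step keeps them nonnegative. In
  \<open>e\<close> the summand 1 in the denominator avoids division by zero, and the inserted 1
  covers the case that every inequality is tight.\<close>

lemma perturb:
  assumes x: "x \<in> P" and v: "v \<in> V (T x)"
  obtains e where "e > 0" "x + e *\<^sub>R v \<in> P" "T x \<subseteq> T (x + e *\<^sub>R v)"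
proof -
  define D where "D = C - T x"
  define e where "e = Min (insert 1 ((\<lambda>c. g c x / (\<bar>h c v\<bar> + 1)) ` D))"
  have fin: "finite D" using finite_C by (simp add: D_def)
  have pos: "g c x > 0" if "c \<in> D" for c
    using that x by (auto simp: D_def T_def P_def order_less_le)
  have e: "e > 0"
    unfolding e_def using fin pos by (subst Min_gr_iff) (auto intro!: divide_pos_pos)
  have tight: "h c v = 0" if "c \<in> T x" for c
    using v that by (simp add: V_def)
  have "g c x + e * h c v \<ge> 0" if "c \<in> C" for c
  proof (cases "c \<in> T x")
    case True
    then show ?thesis using tight by (simp add: T_def)
  next
    case False
    then have c: "c \<in> D" using that by (simp add: D_def)
    have "e \<le> g c x / (\<bar>h c v\<bar> + 1)"
      unfolding e_def using fin c by (intro Min_le) auto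
    then have "e * (\<bar>h c v\<bar> + 1) \<le> g c x"
      by (simp add: pos_le_divide_eq)
    moreover have "- (e * \<bar>h c v\<bar>) \<le> e * h c v"
      using mult_left_mono[of "- \<bar>h c v\<bar>" "h c v" e] e by simp
    ultimately show ?thesis using e by (simp add: algebra_simps)
  qed
  moreover have "x + e *\<^sub>R v \<in> W"
    using x v subspace_W by (simp add: P_def V_def subspace_add subspace_scale)
  ultimately have "x + e *\<^sub>R v \<in> P"
    by (simp add: P_def g_scale)
  moreover have "T x \<subseteq> T (x + e *\<^sub>R v)"
    using tight by (auto simp: T_def g_scale)
  ultimately show thesis using that e by blast
qed

lemma F_face: "F S face_of P"
  unfolding face_of_def
proof (intro conjI ballI impI)
  show "F S \<subseteq> P" by (auto simp: F_def)
  show "convex (F S)"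
    unfolding convex_alt
  proof (intro ballI allI impI)
    fix x y and t :: real
    assume xy: "x \<in> F S" "y \<in> F S" and t: "0 \<le> t \<and> t \<le> 1"
    then have "(1 - t) *\<^sub>R x + t *\<^sub>R y \<in> P"
      by (auto simp: F_def intro: comb_in_P)
    moreover have "S \<subseteq> T ((1 - t) *\<^sub>R x + t *\<^sub>R y)"
      using xy by (auto simp: F_def T_def g_convex_comb subset_iff)
    ultimately show "(1 - t) *\<^sub>R x + t *\<^sub>R y \<in> F S"
      by (simp add: F_def)
  qed
next
  fix a b x
  assume ab: "a \<in> P" "b \<in> P" and x: "x \<in> F S" "x \<in> open_segment a b"
  then obtain t where "0 < t" "t < 1" "x = (1 - t) *\<^sub>R a + t *\<^sub>R b"
    by (auto simp: in_segment)
  with ab have "T x = T a \<inter> T b" by (simp add: T_comb)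
  with ab x show "a \<in> F S" "b \<in> F S" by (auto simp: F_def)
qed

text \<open>The midpoint of \<open>x\<close> and \<open>y\<close> stays in \<open>Q\<close> and is
  tight exactly where both are, so a tight set of least cardinality is contained in every other
  one.\<close>

lemma minimal_tight:
  assumes "convex Q" "Q \<subseteq> P" "Q \<noteq> {}"
  obtains x where "x \<in> Q" "\<And>y. y \<in> Q \<Longrightarrow> T x \<subseteq> T y"
proof -
  obtain x where x: "x \<in> Q" "\<And>y. y \<in> Q \<Longrightarrow> card (T x) \<le> card (T y)"
    using assms(3) ex_has_least_nat[of "\<lambda>x. x \<in> Q" _ "\<lambda>x. card (T x)"] by blast
  have "T x \<subseteq> T y" if y: "y \<in> Q" for y
  proof -
    define m where "m = (1 - 1/2) *\<^sub>R x + (1/2) *\<^sub>R y"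
    have "m \<in> Q"
      using assms(1) x(1) y unfolding convex_alt m_def by (auto elim!: ballE allE[of _ "1/2"])
    then have "card (T x) \<le> card (T m)" by (rule x)
    moreover have m: "T m = T x \<inter> T y"
      unfolding m_def using x(1) y assms(2) by (intro T_comb) auto
    moreover have "finite (T x)" using finite_C by (simp add: T_def)
    ultimately have "T m = T x"
      by (intro card_seteq) auto
    with m show ?thesis by auto
  qed
  with x(1) that show thesis by blast
qed

text \<open>A point of the face with the fewest tight inequalities lies in its relative interior, so every
  segment from a point of \<open>F (T x)\<close> through it can be prolonged inside the polyhedron.\<close>

lemma face_eq_F:
  assumes "Q face_of P" "Q \<noteq> {}"
  obtains x where "x \<in> P" "Q = F (T x)"
proof -
  have QP: "Q \<subseteq> P" "convex Q" using assms(1) by (auto simp: face_of_def)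
  obtain x where x: "x \<in> Q" "\<And>y. y \<in> Q \<Longrightarrow> T x \<subseteq> T y"
    using minimal_tight[OF QP(2,1) assms(2)] by blast
  have xP: "x \<in> P" using x QP by auto
  have "y \<in> Q" if y: "y \<in> P" "T x \<subseteq> T y" for y
  proof (cases "y = x")
    case False
    have "h c (x - y) = 0" if "c \<in> T x" for c
      using that y(2) by (auto simp: h_diff T_def)
    then have "x - y \<in> V (T x)"
      using xP y subspace_W by (auto simp: V_def P_def subspace_diff)
    then obtain e where e: "e > 0" "x + e *\<^sub>R (x - y) \<in> P"
      using perturb[OF xP] by blast
    define z where "z = x + e *\<^sub>R (x - y)"
    have "x = (1 - 1/(1+e)) *\<^sub>R y + (1/(1+e)) *\<^sub>R z"
    proof -
      have "(1 - 1/(1+e)) *\<^sub>R y + (1/(1+e)) *\<^sub>R z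
          = ((1 - 1/(1+e)) - e/(1+e)) *\<^sub>R y + (1/(1+e) + e/(1+e)) *\<^sub>R x"
        by (simp add: z_def algebra_simps)
      moreover have "1/(1+e) + e/(1+e) = 1"
        using e by (simp add: add_divide_distrib[symmetric])
      ultimately show ?thesis by (simp add: diff_diff_eq)
    qed
    moreover have "z \<noteq> y"
    proof
      assume "z = y"
      then have "(1 + e) *\<^sub>R (x - y) = 0" by (simp add: z_def algebra_simps)
      then show False using e False by simp
    qed
    moreover have "0 < 1/(1+e)" "1/(1+e) < 1" using e by auto
    ultimately have "x \<in> open_segment y z"
      unfolding in_segment by blast
    then show ?thesis
      using face_ofD[OF assms(1) _ y(1)] e(2) x(1) by (auto simp: z_def)
  qed (use x in simp)
  then have "Q = F (T x)"
    using x QP by (auto simp: F_def)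
  with xP that show thesis by blast
qed

lemma mem_F_T: "x \<in> P \<Longrightarrow> x \<in> F (T x)"
  by (simp add: F_def)

lemma faces_eq: "{Q. Q face_of P \<and> Q \<noteq> {}} = F ` T ` P"
proof
  show "{Q. Q face_of P \<and> Q \<noteq> {}} \<subseteq> F ` T ` P"
  proof
    fix Q assume "Q \<in> {Q. Q face_of P \<and> Q \<noteq> {}}"
    then obtain x where "x \<in> P" "Q = F (T x)"
      using face_eq_F[of Q] by auto
    then show "Q \<in> F ` T ` P" by simp
  qed
  show "F ` T ` P \<subseteq> {Q. Q face_of P \<and> Q \<noteq> {}}"
    using F_face mem_F_T by fastforce
qed

lemma inj_on_F: "inj_on F (T ` P)"
proof (rule inj_onI)
  fix S S' assume "S \<in> T ` P" "S' \<in> T ` P" and eq: "F S = F S'"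
  then obtain x x' where x: "x \<in> P" "S = T x" "x' \<in> P" "S' = T x'" by auto
  then have "x \<in> F S'" "x' \<in> F S" using mem_F_T eq by auto
  then show "S = S'" using x by (auto simp: F_def)
qed

lemma affine_dim_F:
  assumes x: "x \<in> P"
  shows "affine_dim (F (T x)) = dim (V (T x))"
proof -
  define D where "D = {y - z | y z. y \<in> F (T x) \<and> z \<in> F (T x)}"
  have "D \<subseteq> V (T x)"
    using subspace_W by (auto simp: D_def F_def V_def P_def T_def h_diff subspace_diff subset_iff)
  moreover have "V (T x) \<subseteq> span D"
  proof
    fix v assume "v \<in> V (T x)"
    then obtain e where e: "e > 0" "x + e *\<^sub>R v \<in> P" "T x \<subseteq> T (x + e *\<^sub>R v)"
      using perturb[OF x] by blast
    then have "(x + e *\<^sub>R v) - x \<in> D"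
      using x unfolding D_def F_def by blast
    then have "(1/e) *\<^sub>R ((x + e *\<^sub>R v) - x) \<in> span D"
      by (intro span_scale span_base)
    then show "v \<in> span D" using e by simp
  qed
  ultimately have "span D = span (V (T x))"
    by (metis span_mono span_span subset_antisym)
  then show ?thesis
    unfolding affine_dim_def D_def[symmetric] by (metis real_vector.dim_span)
qed

text \<open>The ambient type may be infinite-dimensional, and \<open>dim\<close> is 0 for a space
  with an infinite basis. Monotonicity of \<open>dim\<close> therefore rests on the finite spanning
  set of \<open>W\<close>.\<close>

lemma V_basis:
  obtains B where "finite B" "B \<subseteq> V S" "independent B" "V S \<subseteq> span B" "card B = dim (V S)"
proof -
  obtain B where B: "B \<subseteq> V S" "independent B" "V S \<subseteq> span B" "card B = dim (V S)"
    using real_vector.basis_exists[of "V S"] by blast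
  obtain B0 where B0: "finite B0" "W \<subseteq> span B0" using W_finite_dim by blast
  have "B \<subseteq> span B0" using B(1) B0(2) by (auto simp: V_def)
  then have "finite B" using real_vector.independent_span_bound[OF B0(1) B(2)] by blast
  with B that show thesis by blast
qed

lemma dim_V_antimono:
  assumes "S \<subseteq> S'"
  shows "dim (V S') \<le> dim (V S)"
proof -
  obtain B where B: "finite B" "V S \<subseteq> span B" "card B = dim (V S)"
    by (rule V_basis[of S])
  have "V S' \<subseteq> V S" using assms by (auto simp: V_def)
  with B(2) have "V S' \<subseteq> span B" by blast
  then show ?thesis using real_vector.dim_le_card B by metis
qed

lemma finite_T_P: "finite (T ` P)"
  by (rule finite_subset[of _ "Pow C"]) (auto simp: T_def finite_C)

text \<open>The polynomial \<open>f_poly P\<close> stops at degree \<open>affine_dim P\<close>, so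
  no face may exceed it. A point with the least tight set has \<open>F (T x) = P\<close>, and fewer
  equations leave more directions.\<close>

lemma affine_dim_P_ge:
  assumes "S \<in> T ` P"
  shows "dim (V S) \<le> affine_dim P"
proof -
  have "convex P" unfolding convex_alt using comb_in_P by blast
  then obtain x where x: "x \<in> P" "\<And>y. y \<in> P \<Longrightarrow> T x \<subseteq> T y"
    using minimal_tight[of P] assms by blast
  then have "F (T x) = P" by (auto simp: F_def)
  then have "affine_dim P = dim (V (T x))" using affine_dim_F x by metis
  then show ?thesis using dim_V_antimono x(2) assms by auto
qed

text \<open>Faces are replaced by the tight sets that name them; what follows is then bookkeeping
  with sets of constraints.\<close>

theorem f_poly_P: "f_poly P = (\<Sum>S \<in> T ` P. monom 1 (dim (V S)))"
proof -
  have num: "f_number P d = card {S \<in> T ` P. dim (V S) = d}" for d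
  proof -
    have "{Q. Q face_of P \<and> Q \<noteq> {} \<and> affine_dim Q = d} = {Q \<in> F ` T ` P. affine_dim Q = d}"
      using faces_eq by auto
    also have "\<dots> = F ` {S \<in> T ` P. dim (V S) = d}"
      using affine_dim_F by auto
    also have "card \<dots> = card {S \<in> T ` P. dim (V S) = d}"
      by (rule card_image) (rule inj_on_subset[OF inj_on_F], auto)
    finally show ?thesis by (simp add: f_number_def)
  qed
  have "(\<Sum>S \<in> T ` P. monom (1::int) (dim (V S)))
      = (\<Sum>d = 0..affine_dim P. \<Sum>S | S \<in> T ` P \<and> dim (V S) = d. monom 1 (dim (V S)))"
    using affine_dim_P_ge by (intro sum.group[symmetric] finite_T_P) auto
  also have "\<dots> = f_poly P"
    unfolding f_poly_def num
    by (intro sum.cong refl) (auto simp: of_nat_monom mult_monom monom_0 smult_monom)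
  finally show ?thesis by simp
qed

end

section \<open>Dimension of a direct sum via dual functionals\<close>

text \<open>The functionals \<open>r x\<close> are dual to the vectors \<open>E x\<close> and vanish
  on the image of \<open>f\<close>. Adding the \<open>E y\<close> one at a time to a basis of that
  image keeps independence, since \<open>r y\<close> kills everything already present but not
  \<open>E y\<close>.\<close>

lemma dim_direct_sum:
  fixes V :: "'b::real_vector set" and K :: "'a::real_vector set"
  assumes lin: "linear f" and inj: "inj_on f K" and K: "subspace K"
    and fin: "\<exists>B. finite B \<and> K \<subseteq> span B" and X: "finite X"
    and rlin: "\<And>x. x \<in> X \<Longrightarrow> linear (r x)"
    and rE: "\<And>x y. x \<in> X \<Longrightarrow> y \<in> X \<Longrightarrow> r x (E y) = (if x = y then 1 else 0 :: real)"
    and rf: "\<And>x v. x \<in> X \<Longrightarrow> v \<in> K \<Longrightarrow> r x (f v) = 0"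
    and sub: "\<And>v. v \<in> K \<Longrightarrow> f v \<in> V" "\<And>x. x \<in> X \<Longrightarrow> E x \<in> V"
    and dec: "\<And>v. v \<in> V \<Longrightarrow> \<exists>w\<in>K. v = f w + (\<Sum>x\<in>X. r x v *\<^sub>R E x)"
  shows "dim V = dim K + card X"
proof -
  obtain B where B: "B \<subseteq> K" "independent B" "K \<subseteq> span B" "card B = dim K"
    using real_vector.basis_exists[of K] by blast
  obtain B0 where B0: "finite B0" "K \<subseteq> span B0" using fin by blast
  have finB: "finite B" using real_vector.independent_span_bound[OF B0(1) B(2)] B(1) B0(2) by blast
  have spanB: "span B = K"
    using B K by (metis span_minimal subset_antisym)
  have indB: "independent (f ` B)"
    using linear_independent_injective_image[OF lin B(2)] inj spanB by simp
  have cardB: "card (f ` B) = card B"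
    by (rule card_image) (rule inj_on_subset[OF inj B(1)])
  have "independent (f ` B \<union> E ` Y) \<and> card (f ` B \<union> E ` Y) = card B + card Y" if "finite Y" "Y \<subseteq> X" for Y
    using that
  proof (induction Y rule: finite_induct)
    case empty
    then show ?case using indB cardB by simp
  next
    case (insert y Y)
    have "r y v = 0" if "v \<in> span (f ` B \<union> E ` Y)" for v
      using insert.prems insert.hyps that B(1)
      by (intro linear_eq_0_on_span[of "r y" "f ` B \<union> E ` Y" v])
        (auto simp: rlin rE rf subset_iff)
    moreover have "r y (E y) = 1" using insert.prems rE by simp
    ultimately have nin: "E y \<notin> span (f ` B \<union> E ` Y)" by force
    then have "E y \<notin> f ` B \<union> E ` Y" using span_base[of "E y" "f ` B \<union> E ` Y"] by argo
    then show ?case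
      using insert nin finB by (simp add: real_vector.independent_insertI)
  qed
  then have ind: "independent (f ` B \<union> E ` X)" and card: "card (f ` B \<union> E ` X) = dim K + card X"
    using X B(4) by auto
  show ?thesis
  proof (rule real_vector.dim_unique[OF _ _ ind card])
    show "f ` B \<union> E ` X \<subseteq> V" using B(1) sub by auto
    show "V \<subseteq> span (f ` B \<union> E ` X)"
    proof
      fix v assume "v \<in> V"
      then obtain w where w: "w \<in> K" "v = f w + (\<Sum>x\<in>X. r x v *\<^sub>R E x)" using dec by blast
      have "f w \<in> span (f ` B)"
        using w(1) spanB linear_span_image[OF lin, of B] by auto
      then have "f w \<in> span (f ` B \<union> E ` X)"
        using span_mono[of "f ` B" "f ` B \<union> E ` X"] by blast
      moreover have "(\<Sum>x\<in>X. r x v *\<^sub>R E x) \<in> span (f ` B \<union> E ` X)"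
        by (intro span_sum span_scale span_base) auto
      ultimately show "v \<in> span (f ` B \<union> E ` X)" using w(2) by (metis span_add)
    qed
  qed
qed

section \<open>Gelfand--Zetlin polytopes as slack polyhedra\<close>

lemma lookup_scaleR_pm: "Poly_Mapping.lookup (r *\<^sub>R x) p = r *\<^sub>R Poly_Mapping.lookup x p"
proof -
  have "finite {p. r *\<^sub>R Poly_Mapping.lookup x p \<noteq> 0}"
    by (rule finite_subset[OF _ finite_keys[of x]]) (auto simp: in_keys_iff)
  then show ?thesis by (simp add: scaleR_poly_mapping_def)
qed

lemma linear_lookup: "linear (\<lambda>v. Poly_Mapping.lookup v p :: real)"
  by (rule linearI) (simp_all add: lookup_add lookup_scaleR_pm)

text \<open>Linear part of \<open>gz_coord\<close>: row 0 is fixed data, so its displacement is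
  0.\<close>

definition gz_hom_coord :: "((nat \<times> nat) \<Rightarrow>\<^sub>0 real) \<Rightarrow> nat \<Rightarrow> nat \<Rightarrow> real" where
  "gz_hom_coord v i j = (if i = 0 then 0 else Poly_Mapping.lookup v (i, j))"

fun gz_slack :: "real list \<Rightarrow> (nat \<times> nat) \<times> bool \<Rightarrow> ((nat \<times> nat) \<Rightarrow>\<^sub>0 real) \<Rightarrow> real" where
  "gz_slack ls ((i, j), b) u =
     (if b then gz_coord ls u (i - 1) (j + 1) - gz_coord ls u i j
      else gz_coord ls u i j - gz_coord ls u (i - 1) j)"

fun gz_hom_slack :: "(nat \<times> nat) \<times> bool \<Rightarrow> ((nat \<times> nat) \<Rightarrow>\<^sub>0 real) \<Rightarrow> real" where
  "gz_hom_slack ((i, j), b) v =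
     (if b then gz_hom_coord v (i - 1) (j + 1) - gz_hom_coord v i j
      else gz_hom_coord v i j - gz_hom_coord v (i - 1) j)"

definition gz_tight :: "real list \<Rightarrow> ((nat \<times> nat) \<Rightarrow>\<^sub>0 real) \<Rightarrow> ((nat \<times> nat) \<times> bool) set" where
  "gz_tight ls u = {c \<in> gz_index (length ls) \<times> UNIV. gz_slack ls c u = 0}"

definition gz_lin :: "nat \<Rightarrow> ((nat \<times> nat) \<times> bool) set \<Rightarrow> ((nat \<times> nat) \<Rightarrow>\<^sub>0 real) set" where
  "gz_lin s S = {v. Poly_Mapping.keys v \<subseteq> gz_index s \<and> (\<forall>c\<in>S. gz_hom_slack c v = 0)}"

lemma finite_gz_index: "finite (gz_index s)"
  by (rule finite_subset[of _ "{..s} \<times> {..s}"]) (auto simp: gz_index_def)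

lemma linear_gz_hom_coord: "linear (\<lambda>v. gz_hom_coord v i j)"
  by (rule linearI) (simp_all add: gz_hom_coord_def lookup_add lookup_scaleR_pm)

lemma linear_gz_hom_slack: "linear (gz_hom_slack c)"
proof -
  obtain i j b where "c = ((i, j), b)" by (metis surj_pair)
  then show ?thesis
    by (cases b)
      (auto intro!: linearI simp: linear_gz_hom_coord[THEN linear_add]
        linear_gz_hom_coord[THEN linear_scale] algebra_simps)
qed

lemma GZ_slack: "GZ ls = {u. Poly_Mapping.keys u \<subseteq> gz_index (length ls) \<and>
    (\<forall>c \<in> gz_index (length ls) \<times> UNIV. gz_slack ls c u \<ge> 0)}"
  unfolding GZ_def by (auto simp: all_bool_eq split: if_splits)

lemma gz_space_span:
  assumes "Poly_Mapping.keys v \<subseteq> gz_index s"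
  shows "v \<in> span ((\<lambda>p. Poly_Mapping.single p (1::real)) ` gz_index s)"
proof -
  have "v = (\<Sum>p\<in>gz_index s. Poly_Mapping.lookup v p *\<^sub>R Poly_Mapping.single p 1)"
  proof (rule poly_mapping_eqI)
    fix q
    show "Poly_Mapping.lookup v q = Poly_Mapping.lookup (\<Sum>p\<in>gz_index s. Poly_Mapping.lookup v p *\<^sub>R Poly_Mapping.single p 1) q"
      using assms finite_gz_index
      by (auto simp: lookup_sum lookup_scaleR_pm lookup_single when_def if_distrib sum.delta' in_keys_iff cong: if_cong)
  qed
  also have "\<dots> \<in> span ((\<lambda>p. Poly_Mapping.single p (1::real)) ` gz_index s)"
    by (intro span_sum span_scale span_base) auto
  finally show ?thesis .
qed

lemma subspace_keys: "subspace {v :: 'b \<Rightarrow>\<^sub>0 real. Poly_Mapping.keys v \<subseteq> I}"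
  unfolding subspace_def by (auto simp: subset_iff in_keys_iff lookup_add lookup_scaleR_pm)
    (metis add_0)

lemma slack_polyhedron_GZ:
  "slack_polyhedron {v. Poly_Mapping.keys v \<subseteq> gz_index (length ls)} (gz_index (length ls) \<times> UNIV)
     (gz_slack ls) gz_hom_slack"
proof
  show "subspace {v :: (nat \<times> nat) \<Rightarrow>\<^sub>0 real. Poly_Mapping.keys v \<subseteq> gz_index (length ls)}"
    by (rule subspace_keys)
  show "\<exists>B. finite B \<and> {v :: (nat \<times> nat) \<Rightarrow>\<^sub>0 real. Poly_Mapping.keys v \<subseteq> gz_index (length ls)} \<subseteq> span B"
    using gz_space_span finite_gz_index by (intro exI[of _ "(\<lambda>p. Poly_Mapping.single p 1) ` gz_index (length ls)"]) auto
  show "gz_slack ls c (x + v) = gz_slack ls c x + gz_hom_slack c v" for c x v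
    by (cases "(ls, c, x)" rule: gz_slack.cases)
      (simp add: gz_coord_def gz_hom_coord_def lookup_add)
qed (simp_all add: finite_gz_index linear_gz_hom_slack linear_add[OF linear_gz_hom_slack]
    linear_scale[OF linear_gz_hom_slack])

lemma f_poly_GZ:
  "f_poly (GZ ls) = (\<Sum>S \<in> gz_tight ls ` GZ ls. monom 1 (dim (gz_lin (length ls) S)))"
proof -
  interpret slack_polyhedron "{v. Poly_Mapping.keys v \<subseteq> gz_index (length ls)}" 
    "gz_index (length ls) \<times> UNIV" "gz_slack ls" gz_hom_slack
    by (rule slack_polyhedron_GZ)
  have "P = GZ ls" "T = gz_tight ls" "V = gz_lin (length ls)"
    by (auto simp: P_def T_def V_def gz_tight_def gz_lin_def GZ_slack fun_eq_iff)
  with f_poly_P show ?thesis by simp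
qed

lemma finite_gz_tight: "finite (gz_tight ls ` A)"
  by (rule finite_subset[of _ "Pow (gz_index (length ls) \<times> UNIV)"])
    (auto simp: gz_tight_def finite_gz_index)

lemma subspace_gz_lin: "subspace (gz_lin s S)"
  using linear_gz_hom_slack subspace_keys[of "gz_index s"]
  unfolding gz_lin_def subspace_def by (auto simp: linear_add linear_0 linear_scale)

lemma gz_lin_finite_dim: "\<exists>B. finite B \<and> gz_lin s S \<subseteq> span B"
  using gz_space_span finite_gz_index
  by (intro exI[of _ "(\<lambda>p. Poly_Mapping.single p 1) ` gz_index s"]) (auto simp: gz_lin_def)

section \<open>Splitting off the first row of a pattern\<close>

definition gz_vec :: "nat \<Rightarrow> (nat \<Rightarrow> nat \<Rightarrow> real) \<Rightarrow> ((nat \<times> nat) \<Rightarrow>\<^sub>0 real)" where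
  "gz_vec s f = Abs_poly_mapping (\<lambda>(i, j). if (i, j) \<in> gz_index s then f i j else 0)"

lemma lookup_gz_vec:
  "Poly_Mapping.lookup (gz_vec s f) (i, j) = (if (i, j) \<in> gz_index s then f i j else 0)"
proof -
  have "finite {p. (case p of (i, j) \<Rightarrow> if (i, j) \<in> gz_index s then f i j else 0) \<noteq> 0}"
    by (rule finite_subset[OF _ finite_gz_index[of s]]) (auto split: if_splits)
  then show ?thesis by (simp add: gz_vec_def)
qed

lemma keys_gz_vec: "Poly_Mapping.keys (gz_vec s f) \<subseteq> gz_index s"
  by (auto simp: in_keys_iff lookup_gz_vec split: if_splits)

lemma gz_eqI:
  assumes "Poly_Mapping.keys u \<subseteq> gz_index s" "Poly_Mapping.keys v \<subseteq> gz_index s"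
    and "\<And>i j. (i, j) \<in> gz_index s \<Longrightarrow> Poly_Mapping.lookup u (i, j) = Poly_Mapping.lookup v (i, j)"
  shows "u = v"
proof (rule poly_mapping_eqI)
  fix p :: "nat \<times> nat"
  show "Poly_Mapping.lookup u p = Poly_Mapping.lookup v p"
    using assms by (cases p) (metis in_keys_iff subsetD)
qed

lemma gz_index_Suc: "(Suc i, j) \<in> gz_index (Suc n) \<longleftrightarrow> (if i = 0 then 1 \<le> j \<and> j \<le> n else (i, j) \<in> gz_index n)"
  by (auto simp: gz_index_def)

lemma gz_index_zero [simp]: "(0, j) \<notin> gz_index s"
  by (simp add: gz_index_def)

lemma gz_index_up:
  assumes "(i, j) \<in> gz_index n"
  shows "(Suc i, j) \<in> gz_index (Suc n)" "(i, j) \<in> gz_index (Suc n)" "(i, Suc j) \<in> gz_index (Suc n)"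
  using assms by (auto simp: gz_index_def)

text \<open>The row \<open>r\<close>, which is row 0 for \<open>u\<close>, becomes a free row 1, and
  all rows of \<open>u\<close> move down by one. \<open>gz_cons0\<close> is the linear part of this
  map in \<open>u\<close>, and \<open>gz_tl\<close> forgets row 1.\<close>

definition gz_cons :: "real list \<Rightarrow> ((nat \<times> nat) \<Rightarrow>\<^sub>0 real) \<Rightarrow> ((nat \<times> nat) \<Rightarrow>\<^sub>0 real)" where
  "gz_cons r u = gz_vec (Suc (length r)) (\<lambda>i j. gz_coord r u (i - 1) j)"

definition gz_cons0 :: "nat \<Rightarrow> ((nat \<times> nat) \<Rightarrow>\<^sub>0 real) \<Rightarrow> ((nat \<times> nat) \<Rightarrow>\<^sub>0 real)" where
  "gz_cons0 n v = gz_vec (Suc n) (\<lambda>i j. gz_hom_coord v (i - 1) j)"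

definition gz_tl :: "nat \<Rightarrow> ((nat \<times> nat) \<Rightarrow>\<^sub>0 real) \<Rightarrow> ((nat \<times> nat) \<Rightarrow>\<^sub>0 real)" where
  "gz_tl n u = gz_vec n (\<lambda>i j. Poly_Mapping.lookup u (Suc i, j))"

definition gz_up :: "((nat \<times> nat) \<times> bool) set \<Rightarrow> ((nat \<times> nat) \<times> bool) set" where
  "gz_up S = {((Suc i, j), b) | i j b. ((i, j), b) \<in> S}"

text \<open>List positions start at 0 and coordinates at 1, hence \<open>Suc j\<close>: coordinate
  \<open>(1, j + 1)\<close> lies between \<open>ls ! j\<close> and
  \<open>ls ! Suc j\<close>.\<close>

definition row_tight :: "real list \<Rightarrow> real list \<Rightarrow> ((nat \<times> nat) \<times> bool) set" where
  "row_tight ls r = {((Suc 0, Suc j), b) | j b. j < length r \<and> r ! j = (if b then ls ! Suc j else ls ! j)}"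

definition interlaces :: "real list \<Rightarrow> real list \<Rightarrow> bool" where
  "interlaces ls r \<longleftrightarrow> length ls = Suc (length r) \<and>
     (\<forall>j < length r. ls ! j \<le> r ! j \<and> r ! j \<le> ls ! Suc j)"

lemma gz_coord_cons:
  assumes "(Suc i, j) \<in> gz_index (Suc (length r))"
  shows "gz_coord ls (gz_cons r u) (Suc i) j = gz_coord r u i j"
  using assms by (simp add: gz_coord_def[of ls] gz_cons_def lookup_gz_vec)

lemma gz_slack_cons_up:
  assumes "(i, j) \<in> gz_index (length r)"
  shows "gz_slack ls ((Suc i, j), b) (gz_cons r u) = gz_slack r ((i, j), b) u"
proof -
  obtain i' where i: "i = Suc i'" using assms by (cases i) auto
  show ?thesis
    using gz_index_up[OF assms] by (simp add: i gz_coord_cons)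
qed

lemma gz_slack_cons_row:
  assumes "j < length r"
  shows "gz_slack ls ((Suc 0, Suc j), b) (gz_cons r u) = (if b then ls ! Suc j - r ! j else r ! j - ls ! j)"
proof -
  have "(Suc 0, Suc j) \<in> gz_index (Suc (length r))" using assms by (simp add: gz_index_Suc)
  then show ?thesis by (simp add: gz_coord_cons) (simp add: gz_coord_def)
qed

lemma gz_index_Suc_cases:
  assumes "(i, j) \<in> gz_index (Suc n)"
  obtains (row) j' where "i = Suc 0" "j = Suc j'" "j' < n"
    | (up) i' where "i = Suc i'" "(i', j) \<in> gz_index n"
proof (cases i)
  case 0
  then show ?thesis using assms by simp
next
  case (Suc i')
  show ?thesis
  proof (cases "i' = 0")
    case True
    then show ?thesis using assms Suc row[of "j - 1"] by (auto simp: gz_index_def)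
  next
    case False
    then show ?thesis using assms Suc up by (simp add: gz_index_Suc)
  qed
qed

lemma gz_cons_in_GZ_iff:
  assumes "length ls = Suc (length r)" "Poly_Mapping.keys u \<subseteq> gz_index (length r)"
  shows "gz_cons r u \<in> GZ ls \<longleftrightarrow> interlaces ls r \<and> u \<in> GZ r"
proof
  assume *: "gz_cons r u \<in> GZ ls"
  then have s: "gz_slack ls c (gz_cons r u) \<ge> 0" if "c \<in> gz_index (Suc (length r)) \<times> UNIV" for c
    using that assms by (auto simp: GZ_slack)
  have "ls ! j \<le> r ! j \<and> r ! j \<le> ls ! Suc j" if "j < length r" for j
    using that s[of "((Suc 0, Suc j), True)"] s[of "((Suc 0, Suc j), False)"]
      gz_slack_cons_row[of j r ls True u] gz_slack_cons_row[of j r ls False u]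
    by (auto simp: gz_index_Suc simp del: gz_slack.simps)
  moreover have "u \<in> GZ r"
    unfolding GZ_slack
  proof (intro CollectI conjI ballI assms(2))
    fix c assume "c \<in> gz_index (length r) \<times> (UNIV :: bool set)"
    then obtain i j b where c: "c = ((i, j), b)" "(i, j) \<in> gz_index (length r)" by auto
    then show "gz_slack r c u \<ge> 0"
      using s[of "((Suc i, j), b)"] gz_slack_cons_up[of i j r ls b u] gz_index_up by auto
  qed
  ultimately show "interlaces ls r \<and> u \<in> GZ r" using assms by (simp add: interlaces_def)
next
  assume *: "interlaces ls r \<and> u \<in> GZ r"
  show "gz_cons r u \<in> GZ ls"
    unfolding GZ_slack
  proof (intro CollectI conjI ballI)
    show "Poly_Mapping.keys (gz_cons r u) \<subseteq> gz_index (length ls)"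
      unfolding gz_cons_def assms by (rule keys_gz_vec)
    fix c assume "c \<in> gz_index (length ls) \<times> (UNIV :: bool set)"
    then obtain i j b where c: "c = ((i, j), b)" "(i, j) \<in> gz_index (Suc (length r))" using assms by auto
    from c(2) show "gz_slack ls c (gz_cons r u) \<ge> 0"
    proof (cases rule: gz_index_Suc_cases)
      case (row j')
      then show ?thesis using * c gz_slack_cons_row[of j' r ls b u]
        by (simp add: interlaces_def del: gz_slack.simps)
    next
      case (up i')
      then have "gz_slack r ((i', j), b) u \<ge> 0" using * unfolding GZ_slack by blast
      with up c show ?thesis using gz_slack_cons_up[of i' j r ls b u] by simp
    qed
  qed
qed

lemma GZ_decompose:
  assumes "u \<in> GZ ls" "length ls = Suc n"
  obtains r u' where "interlaces ls r" "length r = n" "u' \<in> GZ r" "u = gz_cons r u'"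
proof -
  define r where "r = map (\<lambda>j. Poly_Mapping.lookup u (Suc 0, Suc j)) [0..<n]"
  define u' where "u' = gz_tl n u"
  have len: "length r = n" by (simp add: r_def)
  have keys: "Poly_Mapping.keys u' \<subseteq> gz_index (length r)"
    unfolding u'_def gz_tl_def len by (rule keys_gz_vec)
  have "u = gz_cons r u'"
  proof (rule gz_eqI)
    show "Poly_Mapping.keys u \<subseteq> gz_index (Suc n)" using assms by (auto simp: GZ_def)
    show "Poly_Mapping.keys (gz_cons r u') \<subseteq> gz_index (Suc n)"
      unfolding gz_cons_def len by (rule keys_gz_vec)
    fix i j assume ij: "(i, j) \<in> gz_index (Suc n)"
    then show "Poly_Mapping.lookup u (i, j) = Poly_Mapping.lookup (gz_cons r u') (i, j)"
      by (cases rule: gz_index_Suc_cases)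
        (use ij in \<open>auto simp: gz_cons_def lookup_gz_vec len gz_coord_def r_def u'_def gz_tl_def\<close>)
  qed
  with gz_cons_in_GZ_iff[of ls r u'] keys assms len that show thesis by auto
qed

text \<open>Constraints indexed by row 1 see only \<open>ls\<close> and \<open>r\<close>; those
  indexed by lower rows see only \<open>r\<close> and \<open>u\<close> and are the constraints of
  the polytope of \<open>r\<close>, shifted by one row.\<close>

lemma gz_tight_cons:
  assumes "length ls = Suc (length r)"
  shows "gz_tight ls (gz_cons r u) = row_tight ls r \<union> gz_up (gz_tight r u)" (is "?L = ?R")
proof (rule set_eqI)
  fix c :: "(nat \<times> nat) \<times> bool"
  obtain i j b where c: "c = ((i, j), b)" by (metis surj_pair)
  show "c \<in> ?L \<longleftrightarrow> c \<in> ?R"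
  proof (cases "(i, j) \<in> gz_index (Suc (length r))")
    case False
    then show ?thesis
      by (auto simp: c gz_tight_def row_tight_def gz_up_def assms gz_index_up gz_index_Suc
          simp del: gz_slack.simps split: if_splits)
  next
    case True
    then show ?thesis
    proof (cases rule: gz_index_Suc_cases)
      case (row j')
      then show ?thesis using True
        by (auto simp: c gz_tight_def row_tight_def gz_up_def assms gz_slack_cons_row
            simp del: gz_slack.simps split: if_splits)
    next
      case (up i')
      then have "i' \<noteq> 0" by (cases "i' = 0") auto
      with up True show ?thesis
        by (auto simp: c gz_tight_def row_tight_def gz_up_def assms gz_slack_cons_up image_iff
            simp del: gz_slack.simps)
    qed
  qed
qed

section \<open>The tight sets of a Gelfand--Zetlin polytope, row by row\<close>

text \<open>Deeper rows take values that need not occur in the first row, so the map must be defined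
  on the whole line. Points are added in increasing order: the map built so far is kept up to the
  old maximum \<open>m\<close> and continued by the line through \<open>(m, f m)\<close> and
  \<open>(b, f b)\<close>, whose slope is positive.\<close>

lemma strict_mono_extension:
  fixes X :: "real set" and f :: "real \<Rightarrow> real"
  assumes "finite X" "strict_mono_on X f"
  shows "\<exists>\<phi>. strict_mono \<phi> \<and> (\<forall>x\<in>X. \<phi> x = f x)"
  using assms
proof (induction X rule: finite_linorder_max_induct)
  case empty
  show ?case by (auto intro!: exI[of _ "\<lambda>x. x"] simp: strict_mono_def)
next
  case (insert b X)
  then obtain \<phi> where \<phi>: "strict_mono \<phi>" "\<forall>x\<in>X. \<phi> x = f x"
    by (auto simp: strict_mono_on_def)
  show ?case
  proof (cases "X = {}")
    case True
    show ?thesis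
      by (rule exI[of _ "\<lambda>x. x - b + f b"]) (auto simp: True strict_mono_def)
  next
    case False
    define m where "m = Max X"
    have m: "m \<in> X" "m < b" "\<And>x. x \<in> X \<Longrightarrow> x \<le> m"
      using insert False by (auto simp: m_def)
    define q where "q = (f b - f m) / (b - m)"
    have "f m < f b" using insert.prems m by (auto simp: strict_mono_on_def)
    then have q: "q > 0" using m by (simp add: q_def)
    define \<psi> where "\<psi> x = (if x \<le> m then \<phi> x else f m + (x - m) * q)" for x
    have "\<phi> m = f m" using \<phi> m by simp
    have "strict_mono \<psi>"
    proof (rule strict_monoI)
      fix x y :: real assume xy: "x < y"
      consider "y \<le> m" | "x \<le> m" "m < y" | "m < x" using xy by linarith
      then show "\<psi> x < \<psi> y"
      proof cases
        case 1
        then show ?thesis using xy strict_monoD[OF \<phi>(1) xy] by (simp add: \<psi>_def)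
      next
        case 2
        then have "\<phi> x \<le> f m" using \<open>\<phi> m = f m\<close> strict_mono_less_eq[OF \<phi>(1), of x m] by simp
        moreover have "0 < (y - m) * q" using 2 q by simp
        ultimately show ?thesis using 2 by (simp add: \<psi>_def)
      next
        case 3
        then show ?thesis using xy q by (simp add: \<psi>_def)
      qed
    qed
    moreover have "\<psi> b = f b" using m by (simp add: \<psi>_def q_def)
    moreover have "\<psi> x = f x" if "x \<in> X" for x using that m \<phi> by (simp add: \<psi>_def)
    ultimately show ?thesis by auto
  qed
qed

text \<open>Agreement of all strict comparisons also gives agreement of equalities, so the value at
  \<open>r ! j\<close> does not depend on the index chosen for it.\<close>

lemma strict_mono_interpolation:
  fixes r r' :: "real list"
  assumes len: "length r' = length r"
    and cmp: "\<And>j l. j < length r \<Longrightarrow> l < length r \<Longrightarrow> r ! j < r ! l \<longleftrightarrow> r' ! j < r' ! l"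
  shows "\<exists>\<phi>. strict_mono \<phi> \<and> map \<phi> r = r'"
proof -
  define f where "f x = r' ! (SOME j. j < length r \<and> r ! j = x)" for x
  have f: "f (r ! j) = r' ! j" if "j < length r" for j
  proof -
    define l where "l = (SOME l. l < length r \<and> r ! l = r ! j)"
    have l: "l < length r \<and> r ! l = r ! j"
      unfolding l_def using that by (rule_tac someI_ex) auto
    then have "\<not> r' ! l < r' ! j" "\<not> r' ! j < r' ! l"
      using cmp[of l j] cmp[of j l] that by auto
    then show ?thesis by (simp add: f_def l_def[symmetric])
  qed
  have "strict_mono_on (set r) f"
    using f cmp by (auto simp: strict_mono_on_def in_set_conv_nth)
  then obtain \<phi> where "strict_mono \<phi>" "\<forall>x\<in>set r. \<phi> x = f x"
    using strict_mono_extension[of "set r" f] by auto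
  moreover from this f len have "map \<phi> r = r'"
    by (auto intro!: nth_equalityI)
  ultimately show ?thesis by blast
qed

text \<open>Interlacing and \<open>r ! j < r ! l\<close> force \<open>j < l\<close>. If
  \<open>r' ! j < r' ! l\<close> failed, both entries would be tight against one common value of
  \<open>ls\<close>; equal tight sets carry this over to \<open>r\<close>, where it contradicts
  \<open>r ! j < r ! l\<close>.\<close>

lemma interlaces_less_imp_less:
  assumes ls: "sorted ls" and r: "interlaces ls r" and r': "interlaces ls r'"
    and tight: "row_tight ls r = row_tight ls r'"
    and less: "r ! j < r ! l" and jl: "j < length r" "l < length r"
  shows "r' ! j < r' ! l"
proof (rule ccontr)
  assume "\<not> r' ! j < r' ! l"
  have len: "length r' = length r" "length ls = Suc (length r)" using r r' by (auto simp: interlaces_def)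
  have mono: "ls ! a \<le> ls ! b" if "a \<le> b" "b \<le> length r" for a b
    using sorted_nth_mono[OF ls that(1)] that len by simp
  have "j < l"
  proof (rule ccontr)
    assume "\<not> j < l"
    with less have "l < j" by (cases "l = j") auto
    then have "ls ! Suc l \<le> ls ! j" "r ! l \<le> ls ! Suc l" "ls ! j \<le> r ! j"
      using r jl mono[of "Suc l" j] by (simp_all add: interlaces_def)
    with less show False by simp
  qed
  then have "ls ! Suc j \<le> ls ! l" using mono jl by simp
  moreover have "r' ! j \<le> ls ! Suc j" "ls ! l \<le> r' ! l"
    using r' jl len by (simp_all add: interlaces_def)
  ultimately have "r' ! j = ls ! Suc j" "r' ! l = ls ! l" "ls ! Suc j = ls ! l"
    using \<open>\<not> r' ! j < r' ! l\<close> by linarith+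
  then have "((Suc 0, Suc j), True) \<in> row_tight ls r" "((Suc 0, Suc l), False) \<in> row_tight ls r"
    unfolding tight using jl len by (auto simp: row_tight_def)
  with \<open>ls ! Suc j = ls ! l\<close> less show False by (auto simp: row_tight_def)
qed

definition gz_map :: "(real \<Rightarrow> real) \<Rightarrow> nat \<Rightarrow> ((nat \<times> nat) \<Rightarrow>\<^sub>0 real) \<Rightarrow> ((nat \<times> nat) \<Rightarrow>\<^sub>0 real)" where
  "gz_map \<phi> n u = gz_vec n (\<lambda>i j. \<phi> (Poly_Mapping.lookup u (i, j)))"

lemma gz_coord_map:
  assumes "(i, j) \<in> gz_index (length r)"
  shows "gz_coord (map \<phi> r) (gz_map \<phi> (length r) u) i j = \<phi> (gz_coord r u i j)"
    and "gz_coord (map \<phi> r) (gz_map \<phi> (length r) u) (i - Suc 0) j = \<phi> (gz_coord r u (i - Suc 0) j)"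
    and "gz_coord (map \<phi> r) (gz_map \<phi> (length r) u) (i - Suc 0) (Suc j) = \<phi> (gz_coord r u (i - Suc 0) (Suc j))"
  using assms by (auto simp: gz_coord_def gz_map_def lookup_gz_vec gz_index_def)

text \<open>Each slack compares two entries of the pattern, so whether it vanishes depends only on
  their order, which a strictly increasing map preserves.\<close>

lemma gz_map_tight:
  assumes "strict_mono \<phi>"
  shows "gz_tight (map \<phi> r) (gz_map \<phi> (length r) u) = gz_tight r u"
  unfolding gz_tight_def
  by (auto simp: gz_coord_map strict_mono_eq[OF assms] split: if_splits)

lemma gz_map_GZ:
  assumes "strict_mono \<phi>" "u \<in> GZ r"
  shows "gz_map \<phi> (length r) u \<in> GZ (map \<phi> r)"
  using assms(2) keys_gz_vec[of "length r" "\<lambda>i j. \<phi> (Poly_Mapping.lookup u (i, j))"]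
  unfolding GZ_def gz_map_def[symmetric]
  by (auto simp: gz_coord_map strict_mono_less_eq[OF assms(1)])

text \<open>One row for each face of the cube of rows interlacing with \<open>ls\<close>, namely the barycenter of that face.\<close>

definition rep_rows :: "real list \<Rightarrow> real list set" where
  "rep_rows ls = {r. length ls = Suc (length r) \<and>
     (\<forall>j < length r. r ! j \<in> {ls ! j, (ls ! j + ls ! Suc j) / 2, ls ! Suc j})}"

lemma rep_rows_interlaces:
  assumes "sorted ls" "r \<in> rep_rows ls"
  shows "interlaces ls r"
proof -
  have "ls ! j \<le> ls ! Suc j" if "j < length r" for j
    using assms that by (auto simp: rep_rows_def intro: sorted_nth_mono)
  then show ?thesis using assms(2) by (fastforce simp: interlaces_def rep_rows_def)
qed

lemma finite_rep_rows: "finite (rep_rows ls)"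
proof (rule finite_subset)
  define A where "A = set ls \<union> (\<lambda>(a, b). (a + b) / 2) ` (set ls \<times> set ls)"
  show "finite {r. set r \<subseteq> A \<and> length r = length ls - 1}"
    by (rule finite_lists_length_eq) (simp add: A_def)
  show "rep_rows ls \<subseteq> {r. set r \<subseteq> A \<and> length r = length ls - 1}"
    unfolding rep_rows_def A_def
    by (auto simp: in_set_conv_nth image_iff) (metis less_Suc_eq Suc_less_eq nth_mem)
qed

lemma rep_rows_inj:
  assumes "r \<in> rep_rows ls" "r' \<in> rep_rows ls" "row_tight ls r = row_tight ls r'"
  shows "r = r'"
proof (rule nth_equalityI)
  show len: "length r = length r'" using assms by (simp add: rep_rows_def)
  fix j assume j: "j < length r"
  have t: "((Suc 0, Suc j), b) \<in> row_tight ls r \<longleftrightarrow> r ! j = (if b then ls ! Suc j else ls ! j)"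
      "((Suc 0, Suc j), b) \<in> row_tight ls r' \<longleftrightarrow> r' ! j = (if b then ls ! Suc j else ls ! j)" for b
    using j len by (auto simp: row_tight_def)
  have "r ! j \<in> {ls ! j, (ls ! j + ls ! Suc j) / 2, ls ! Suc j}"
    "r' ! j \<in> {ls ! j, (ls ! j + ls ! Suc j) / 2, ls ! Suc j}"
    using assms(1,2) j len by (simp_all add: rep_rows_def)
  moreover have "r ! j = ls ! j \<longleftrightarrow> r' ! j = ls ! j" "r ! j = ls ! Suc j \<longleftrightarrow> r' ! j = ls ! Suc j"
    using assms(3) t[of True] t[of False] by simp_all
  ultimately show "r ! j = r' ! j" by (metis empty_iff insert_iff)
qed

text \<open>An entry at neither of its bounds forces, by interlacing,
  \<open>ls ! j < ls ! Suc j\<close>; the midpoint that replaces it is then at neither bound as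
  well.\<close>

lemma rep_row_exists:
  assumes "interlaces ls r"
  obtains r' where "r' \<in> rep_rows ls" "row_tight ls r' = row_tight ls r"
proof
  define r' where "r' = map (\<lambda>j. if r ! j = ls ! j then ls ! j
    else if r ! j = ls ! Suc j then ls ! Suc j else (ls ! j + ls ! Suc j) / 2) [0..<length r]"
  show "r' \<in> rep_rows ls"
    using assms by (auto simp: rep_rows_def interlaces_def r'_def)
  have "r' ! j = (if b then ls ! Suc j else ls ! j) \<longleftrightarrow> r ! j = (if b then ls ! Suc j else ls ! j)"
    if "j < length r" for j b
  proof -
    have "r' ! j = (if r ! j = ls ! j then ls ! j
        else if r ! j = ls ! Suc j then ls ! Suc j else (ls ! j + ls ! Suc j) / 2)"
      using that by (simp add: r'_def)
    moreover have "ls ! j \<le> r ! j" "r ! j \<le> ls ! Suc j"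
      using assms that by (simp_all add: interlaces_def)
    ultimately show ?thesis by (cases b) auto
  qed
  moreover have "length r' = length r" by (simp add: r'_def)
  ultimately show "row_tight ls r' = row_tight ls r"
    unfolding row_tight_def by (simp cong: conj_cong)
qed

lemma gz_up_inject: "gz_up S = gz_up S' \<longleftrightarrow> S = S'"
proof
  assume eq: "gz_up S = gz_up S'"
  have mem: "((Suc i, j), b) \<in> gz_up A \<longleftrightarrow> ((i, j), b) \<in> A" for i j b A
    by (simp add: gz_up_def)
  have "((i, j), b) \<in> S \<longleftrightarrow> ((i, j), b) \<in> S'" for i j b
    using mem[of i j b S] mem[of i j b S'] eq by simp
  then show "S = S'" by (intro set_eqI) (metis surj_pair)
qed simp

lemma gz_tight_index: "gz_tight r u \<subseteq> gz_index (length r) \<times> UNIV"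
  by (auto simp: gz_tight_def)

text \<open>In bijective form the sum over tight sets can be reindexed and split by rows. The
  pattern below a row enters only through its tight set \<open>S\<close>, never as a point.\<close>

lemma tight_sets_GZ:
  assumes "sorted ls" "ls \<noteq> []"
  shows "bij_betw (\<lambda>(r, S). row_tight ls r \<union> gz_up S)
    (SIGMA r : rep_rows ls. gz_tight r ` GZ r) (gz_tight ls ` GZ ls)"
  unfolding bij_betw_def
proof
  \<comment> \<open>Constraints in \<open>row_tight\<close> have row index 1, and those in
    \<open>gz_up\<close> have index at least 2, because rows are numbered from 1 before the shift.
    The union thus determines both parts.\<close>
  have rows: "\<And>c r. c \<in> row_tight ls r \<Longrightarrow> fst (fst c) = Suc 0"
    "\<And>c r u. c \<in> gz_up (gz_tight r u) \<Longrightarrow> fst (fst c) \<noteq> Suc 0"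
    using gz_tight_index by (force simp: row_tight_def gz_up_def)+
  have key: "r = r' \<and> gz_tight r u = gz_tight r' u'"
    if "row_tight ls r \<union> gz_up (gz_tight r u) = row_tight ls r' \<union> gz_up (gz_tight r' u')"
      "r \<in> rep_rows ls" "r' \<in> rep_rows ls" for r r' u u'
  proof -
    have "row_tight ls r = row_tight ls r'" "gz_up (gz_tight r u) = gz_up (gz_tight r' u')"
      using that(1) rows(1)[of _ r] rows(1)[of _ r'] rows(2)[of _ r u] rows(2)[of _ r' u'] by blast+
    with that rep_rows_inj[of r ls r'] show ?thesis by (simp add: gz_up_inject)
  qed
  show "inj_on (\<lambda>(r, S). row_tight ls r \<union> gz_up S) (SIGMA r : rep_rows ls. gz_tight r ` GZ r)"
  proof (rule inj_onI)
    fix p q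
    assume "p \<in> (SIGMA r : rep_rows ls. gz_tight r ` GZ r)" "q \<in> (SIGMA r : rep_rows ls. gz_tight r ` GZ r)"
      and eq: "(case p of (r, S) \<Rightarrow> row_tight ls r \<union> gz_up S) = (case q of (r, S) \<Rightarrow> row_tight ls r \<union> gz_up S)"
    then obtain r u r' u' where pq: "p = (r, gz_tight r u)" "r \<in> rep_rows ls" "q = (r', gz_tight r' u')" "r' \<in> rep_rows ls"
      by auto
    have "r = r' \<and> gz_tight r u = gz_tight r' u'"
      by (rule key) (use eq pq in simp_all)
    then show "p = q" using pq(1,3) by blast
  qed
  show "(\<lambda>(r, S). row_tight ls r \<union> gz_up S) ` (SIGMA r : rep_rows ls. gz_tight r ` GZ r) = gz_tight ls ` GZ ls"
  proof (intro subset_antisym subsetI)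
    fix S assume "S \<in> (\<lambda>(r, S). row_tight ls r \<union> gz_up S) ` (SIGMA r : rep_rows ls. gz_tight r ` GZ r)"
    then obtain r u where ru: "r \<in> rep_rows ls" "u \<in> GZ r" "S = row_tight ls r \<union> gz_up (gz_tight r u)"
      by auto
    then have il: "interlaces ls r" using rep_rows_interlaces assms(1) by blast
    then have len: "length ls = Suc (length r)" by (simp add: interlaces_def)
    have "gz_cons r u \<in> GZ ls"
      using gz_cons_in_GZ_iff[OF len, of u] ru(2) il by (simp add: GZ_def)
    moreover have "S = gz_tight ls (gz_cons r u)"
      using gz_tight_cons[OF len] ru(3) by simp
    ultimately show "S \<in> gz_tight ls ` GZ ls" by blast
  next
    fix S assume "S \<in> gz_tight ls ` GZ ls"
    then obtain u where u: "u \<in> GZ ls" "S = gz_tight ls u" by blast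
    have "length ls = Suc (length ls - 1)" using assms by simp
    from GZ_decompose[OF u(1) this] obtain r u' where
      r: "interlaces ls r" "u' \<in> GZ r" "u = gz_cons r u'" by blast
    then have S: "S = row_tight ls r \<union> gz_up (gz_tight r u')"
      using gz_tight_cons[of ls r u'] u(2) by (simp add: interlaces_def)
    obtain r' where r': "r' \<in> rep_rows ls" "row_tight ls r' = row_tight ls r"
      using rep_row_exists r by blast
    have il': "interlaces ls r'" using rep_rows_interlaces assms(1) r'(1) by blast
    have len: "length r' = length r" using r il' by (simp add: interlaces_def)
    \<comment> \<open>The comparison lemma is used with both orders of the rows, since interpolation
      needs an equivalence of comparisons.\<close>
    have "\<exists>\<phi>. strict_mono \<phi> \<and> map \<phi> r = r'"
      using interlaces_less_imp_less[OF assms(1) r(1) il' r'(2)[symmetric]]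
        interlaces_less_imp_less[OF assms(1) il' r(1) r'(2)] len
      by (intro strict_mono_interpolation) auto
    then obtain \<phi> where \<phi>: "strict_mono \<phi>" "map \<phi> r = r'" by blast
    then have "gz_tight r' (gz_map \<phi> (length r) u') = gz_tight r u'" "gz_map \<phi> (length r) u' \<in> GZ r'"
      using gz_map_tight[OF \<phi>(1), of r u'] gz_map_GZ[OF \<phi>(1) r(2)] by simp_all
    then have "gz_tight r u' \<in> gz_tight r' ` GZ r'" by (metis imageI)
    moreover have "S = row_tight ls r' \<union> gz_up (gz_tight r u')" using S r'(2) by simp
    ultimately show "S \<in> (\<lambda>(r, S). row_tight ls r \<union> gz_up S) ` (SIGMA r : rep_rows ls. gz_tight r ` GZ r)"
      using r'(1) by (auto intro!: image_eqI[of _ _ "(r', gz_tight r u')"])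
  qed
qed

section \<open>Dimension count and recursion over representative rows\<close>

text \<open>Two row entries at different positions are separated by an entry of \<open>ls\<close>;
  if they were equal, that entry would have the same value.\<close>

lemma interlaces_new_strict:
  assumes "sorted ls" "interlaces ls r" "j < length r" "l < length r" "r ! j = r ! l" "r ! j \<notin> set ls"
  shows "j = l"
proof -
  have *: False if "a < b" "b < length r" "r ! a = r ! b" "r ! a \<notin> set ls" for a b
  proof -
    have len: "length ls = Suc (length r)" using assms(2) by (simp add: interlaces_def)
    have "r ! a \<le> ls ! Suc a" "ls ! b \<le> r ! b"
      using assms(2) that(1,2) by (simp_all add: interlaces_def)
    moreover have "ls ! Suc a \<le> ls ! b"
      using that len by (intro sorted_nth_mono[OF assms(1)]) auto
    ultimately have "r ! a = ls ! b" using that(3) by linarith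
    with that(2,4) len show False by simp
  qed
  show ?thesis using *[of j l] *[of l j] assms by (metis linorder_neqE_nat)
qed

text \<open>A nondecreasing list has no entry strictly between two consecutive ones.\<close>

lemma interlaces_old_tight:
  assumes "sorted ls" "interlaces ls r" "j < length r" "r ! j \<in> set ls"
  shows "r ! j = ls ! j \<or> r ! j = ls ! Suc j"
proof -
  have len: "length ls = Suc (length r)" using assms(2) by (simp add: interlaces_def)
  obtain m where m: "m < length ls" "ls ! m = r ! j" using assms(4) by (auto simp: in_set_conv_nth)
  have "ls ! j \<le> r ! j" "r ! j \<le> ls ! Suc j" using assms(2,3) by (simp_all add: interlaces_def)
  moreover have "ls ! m \<le> ls ! j \<or> ls ! Suc j \<le> ls ! m"
    using sorted_nth_mono[OF assms(1), of m j] sorted_nth_mono[OF assms(1), of "Suc j" m] m(1) len assms(3)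
    by (cases "m \<le> j") auto
  ultimately show ?thesis using m(2) by linarith
qed

lemma gz_hom_coord_cons0:
  assumes "(Suc i, j) \<in> gz_index (Suc n)"
  shows "gz_hom_coord (gz_cons0 n v) (Suc i) j = gz_hom_coord v i j"
  using assms unfolding gz_hom_coord_def[of "gz_cons0 n v"] unfolding gz_cons0_def lookup_gz_vec by simp

lemma gz_hom_slack_cons0_up:
  assumes "(i, j) \<in> gz_index n"
  shows "gz_hom_slack ((Suc i, j), b) (gz_cons0 n v) = gz_hom_slack ((i, j), b) v"
proof -
  obtain i' where i: "i = Suc i'" using assms by (cases i) auto
  show ?thesis
    using gz_index_up[OF assms] by (simp add: i gz_hom_coord_cons0)
qed

lemma gz_hom_slack_cons0_row:
  assumes "j < n"
  shows "gz_hom_slack ((Suc 0, Suc j), b) (gz_cons0 n v) = 0"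
proof -
  have "(Suc 0, Suc j) \<in> gz_index (Suc n)" using assms by (simp add: gz_index_Suc)
  then show ?thesis by (simp add: gz_hom_coord_cons0) (simp add: gz_hom_coord_def)
qed

lemma gz_cons0_in_gz_lin_iff:
  assumes "Poly_Mapping.keys v \<subseteq> gz_index (length r)"
  shows "gz_cons0 (length r) v \<in> gz_lin (Suc (length r)) (row_tight ls r \<union> gz_up (gz_tight r u))
    \<longleftrightarrow> v \<in> gz_lin (length r) (gz_tight r u)"
proof -
  have "Poly_Mapping.keys (gz_cons0 (length r) v) \<subseteq> gz_index (Suc (length r))"
    unfolding gz_cons0_def by (rule keys_gz_vec)
  moreover have "gz_hom_slack c (gz_cons0 (length r) v) = 0" if "c \<in> row_tight ls r" for c
    using that gz_hom_slack_cons0_row by (auto simp: row_tight_def simp del: gz_hom_slack.simps)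
  moreover have "(\<forall>c\<in>gz_up (gz_tight r u). gz_hom_slack c (gz_cons0 (length r) v) = 0)
    \<longleftrightarrow> (\<forall>c\<in>gz_tight r u. gz_hom_slack c v = 0)"
  proof -
    have "gz_hom_slack ((Suc i, j), b) (gz_cons0 (length r) v) = gz_hom_slack ((i, j), b) v"
      if "((i, j), b) \<in> gz_tight r u" for i j b
      using that gz_tight_index[of r u] by (intro gz_hom_slack_cons0_up) auto
    then show ?thesis by (auto simp: gz_up_def simp del: gz_hom_slack.simps)
  qed
  ultimately show ?thesis using assms by (auto simp: gz_lin_def)
qed

text \<open>Entries equal to each other stay equal along this direction, which is why it respects all tight
  inequalities; for a value \<open>x\<close> not in the fixed row it moves exactly the entries equal to \<open>x\<close>.\<close>

definition gz_indicator :: "real list \<Rightarrow> ((nat \<times> nat) \<Rightarrow>\<^sub>0 real) \<Rightarrow> real \<Rightarrow> ((nat \<times> nat) \<Rightarrow>\<^sub>0 real)" where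
  "gz_indicator ls u x = gz_vec (length ls) (\<lambda>i j. of_bool (gz_coord ls u i j = x))"

text \<open>In row 0 the homogeneous coordinate is 0, and the formula extends to it because
  \<open>x\<close> does not occur in \<open>ls\<close>. So one formula also serves the constraints
  between rows 0 and 1.\<close>

lemma gz_hom_coord_indicator:
  assumes "(i, j) \<in> gz_index (length ls) \<or> i = 0 \<and> 1 \<le> j \<and> j \<le> length ls" "x \<notin> set ls"
  shows "gz_hom_coord (gz_indicator ls u x) i j = of_bool (gz_coord ls u i j = x)"
  using assms by (auto simp: gz_hom_coord_def gz_indicator_def lookup_gz_vec gz_coord_def)

lemma gz_indicator_in_gz_lin:
  assumes "x \<notin> set ls"
  shows "gz_indicator ls u x \<in> gz_lin (length ls) (gz_tight ls u)"
proof -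
  have "gz_hom_slack c (gz_indicator ls u x) = 0" if "c \<in> gz_tight ls u" for c
  proof -
    obtain i j b where c: "c = ((i, j), b)" by (metis surj_pair)
    have ij: "(i, j) \<in> gz_index (length ls)" and s: "gz_slack ls ((i, j), b) u = 0"
      using that by (auto simp: c gz_tight_def simp del: gz_slack.simps)
    have "gz_hom_coord (gz_indicator ls u x) i j = of_bool (gz_coord ls u i j = x)"
      "gz_hom_coord (gz_indicator ls u x) (i - 1) j = of_bool (gz_coord ls u (i - 1) j = x)"
      "gz_hom_coord (gz_indicator ls u x) (i - 1) (j + 1) = of_bool (gz_coord ls u (i - 1) (j + 1) = x)"
      using ij by (intro gz_hom_coord_indicator assms; fastforce simp: gz_index_def)+
    with s show ?thesis by (auto simp: c split: if_splits)
  qed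
  then show ?thesis by (auto simp: gz_lin_def gz_indicator_def intro: subsetD[OF keys_gz_vec])
qed

text \<open>Row 1 of an admissible direction is determined by its values at the new entries, and
  each of these can be prescribed by an indicator. Subtracting those indicators leaves a direction
  that is zero in row 1, which is an admissible direction of the pattern below with \<open>r\<close>
  held fixed.\<close>

lemma dim_gz_lin_cons:
  assumes sorted: "sorted ls" and il: "interlaces ls r"
  shows "dim (gz_lin (length ls) (row_tight ls r \<union> gz_up (gz_tight r u))) =
    dim (gz_lin (length r) (gz_tight r u)) + card (set r - set ls)"
proof -
  define n where "n = length r"
  define V where "V = gz_lin (length ls) (row_tight ls r \<union> gz_up (gz_tight r u))"
  define K where "K = gz_lin n (gz_tight r u)"
  define X where "X = set r - set ls"
  define U where "U = gz_cons r u"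
  define pos where "pos x = (SOME j. j < n \<and> r ! j = x)" for x
  define E where "E = gz_indicator ls U"
  have len: "length ls = Suc n" using il by (simp add: interlaces_def n_def)
  have V_eq: "V = gz_lin (length ls) (gz_tight ls U)"
    using gz_tight_cons[of ls r u] len by (simp add: V_def U_def n_def)
  have pos: "pos x < n \<and> r ! pos x = x" if "x \<in> X" for x
    unfolding pos_def using that by (rule_tac someI_ex) (auto simp: X_def n_def in_set_conv_nth)
  have row: "(Suc 0, Suc j) \<in> gz_index (Suc n)" if "j < n" for j
    using that by (simp add: gz_index_Suc)
  have E_row: "Poly_Mapping.lookup (E x) (Suc 0, Suc j) = of_bool (r ! j = x)" if "j < n" for j x
  proof -
    have "gz_coord ls U (Suc 0) (Suc j) = r ! j"
      unfolding U_def using row[OF that] by (subst gz_coord_cons) (auto simp: n_def gz_coord_def)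
    then show ?thesis
      unfolding E_def gz_indicator_def using row[OF that] by (simp add: lookup_gz_vec len)
  qed
  have finX: "finite X" by (simp add: X_def)
  have subV: "subspace V" unfolding V_def by (rule subspace_gz_lin)
  have EV: "E x \<in> V" if "x \<in> X" for x
    unfolding V_eq E_def using that by (intro gz_indicator_in_gz_lin) (simp add: X_def)
  have row_zero: "Poly_Mapping.lookup (v - (\<Sum>x\<in>X. Poly_Mapping.lookup v (Suc 0, Suc (pos x)) *\<^sub>R E x)) (Suc 0, Suc j) = 0"
    if v: "v \<in> V" and j: "j < n" for v j
  proof -
    have sum: "Poly_Mapping.lookup (\<Sum>x\<in>X. Poly_Mapping.lookup v (Suc 0, Suc (pos x)) *\<^sub>R E x) (Suc 0, Suc j)
       = (\<Sum>x\<in>X. if x = r ! j then Poly_Mapping.lookup v (Suc 0, Suc (pos x)) else 0)"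
      unfolding lookup_sum lookup_scaleR_pm E_row[OF j] by (intro sum.cong) auto
    show ?thesis
    proof (cases "r ! j \<in> X")
      case True
      then have "pos (r ! j) = j"
        using pos[OF True] j by (intro interlaces_new_strict[OF sorted il]) (auto simp: n_def X_def)
      then show ?thesis using True finX by (simp add: lookup_minus sum)
    next
      case False
      \<comment> \<open>An entry with an old value is tight against one of its two fixed bounds, so
        no admissible direction moves it.\<close>
      then have "r ! j = ls ! j \<or> r ! j = ls ! Suc j"
        using j by (intro interlaces_old_tight[OF sorted il]) (auto simp: n_def X_def)
      then obtain b where "r ! j = (if b then ls ! Suc j else ls ! j)"
        by (metis (full_types))
      then have "((Suc 0, Suc j), b) \<in> row_tight ls r"
        using j by (simp add: row_tight_def n_def)
      then have "gz_hom_slack ((Suc 0, Suc j), b) v = 0" using v by (auto simp: V_def gz_lin_def simp del: gz_hom_slack.simps)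
      then have "Poly_Mapping.lookup v (Suc 0, Suc j) = 0" by (simp add: gz_hom_coord_def split: if_splits)
      moreover have "(\<Sum>x\<in>X. if x = r ! j then Poly_Mapping.lookup v (Suc 0, Suc (pos x)) else 0) = 0"
        using False by (intro sum.neutral) auto
      ultimately show ?thesis by (simp add: lookup_minus sum)
    qed
  qed
  have cons0_tl: "v = gz_cons0 n (gz_tl n v)"
    if keys: "Poly_Mapping.keys v \<subseteq> gz_index (Suc n)" and zero: "\<And>j. j < n \<Longrightarrow> Poly_Mapping.lookup v (Suc 0, Suc j) = 0" for v
  proof (rule gz_eqI[OF keys])
    show "Poly_Mapping.keys (gz_cons0 n (gz_tl n v)) \<subseteq> gz_index (Suc n)"
      unfolding gz_cons0_def by (rule keys_gz_vec)
    fix i j assume ij: "(i, j) \<in> gz_index (Suc n)"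
    then show "Poly_Mapping.lookup v (i, j) = Poly_Mapping.lookup (gz_cons0 n (gz_tl n v)) (i, j)"
      by (cases rule: gz_index_Suc_cases)
        (use ij in \<open>auto simp: gz_cons0_def lookup_gz_vec gz_hom_coord_def zero gz_tl_def\<close>)
  qed
  have keysK: "Poly_Mapping.keys v \<subseteq> gz_index n" if "v \<in> K" for v using that by (simp add: K_def gz_lin_def)
  have "dim V = dim K + card X"
  proof (rule dim_direct_sum[where f = "gz_cons0 n" and E = E and r = "\<lambda>x v. Poly_Mapping.lookup v (Suc 0, Suc (pos x))"])
    show "linear (gz_cons0 n)"
      by (rule linearI; rule poly_mapping_eqI; clarsimp simp: gz_cons0_def lookup_gz_vec lookup_add lookup_scaleR_pm gz_hom_coord_def)
    show "inj_on (gz_cons0 n) K"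
    proof (rule inj_onI)
      fix v w assume vw: "v \<in> K" "w \<in> K" "gz_cons0 n v = gz_cons0 n w"
      show "v = w"
      proof (rule gz_eqI[OF keysK keysK, OF vw(1,2)])
        fix i j assume ij: "(i, j) \<in> gz_index n"
        then have "gz_hom_coord v i j = gz_hom_coord w i j"
          using gz_hom_coord_cons0[of i j n] vw(3) gz_index_up(1) by metis
        with ij show "Poly_Mapping.lookup v (i, j) = Poly_Mapping.lookup w (i, j)"
          by (cases "i = 0") (auto simp: gz_hom_coord_def)
      qed
    qed
    show "subspace K" unfolding K_def by (rule subspace_gz_lin)
    show "\<exists>B. finite B \<and> K \<subseteq> span B" unfolding K_def by (rule gz_lin_finite_dim)
    show "finite X" by (rule finX)
    show "linear (\<lambda>v. Poly_Mapping.lookup v (Suc 0, Suc (pos x)) :: real)" for x by (rule linear_lookup)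
    show "Poly_Mapping.lookup (E y) (Suc 0, Suc (pos x)) = (if x = y then 1 else 0)" if "x \<in> X" "y \<in> X" for x y
      using pos[OF that(1)] by (auto simp: E_row)
    show "Poly_Mapping.lookup (gz_cons0 n v) (Suc 0, Suc (pos x)) = 0" for x v
      by (simp add: gz_cons0_def lookup_gz_vec gz_hom_coord_def)
    show "gz_cons0 n v \<in> V" if "v \<in> K" for v
      using gz_cons0_in_gz_lin_iff[of v r ls u] that keysK[OF that] by (simp add: V_def K_def n_def[symmetric] len)
    show "E x \<in> V" if "x \<in> X" for x using EV that .
    show "\<exists>w\<in>K. v = gz_cons0 n w + (\<Sum>x\<in>X. Poly_Mapping.lookup v (Suc 0, Suc (pos x)) *\<^sub>R E x)"
      if v: "v \<in> V" for v
    proof -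
      define s where "s = (\<Sum>x\<in>X. Poly_Mapping.lookup v (Suc 0, Suc (pos x)) *\<^sub>R E x)"
      have vs: "v - s \<in> V"
        unfolding s_def using subV v EV by (intro subspace_diff subspace_sum subspace_scale) auto
      then have eq: "v - s = gz_cons0 n (gz_tl n (v - s))"
        using row_zero[OF v] by (intro cons0_tl) (auto simp: V_def gz_lin_def len s_def)
      moreover have "gz_tl n (v - s) \<in> K"
        using gz_cons0_in_gz_lin_iff[of "gz_tl n (v - s)" r ls u] vs eq keys_gz_vec[of n]
        by (simp add: K_def V_def n_def[symmetric] len gz_tl_def)
      ultimately show ?thesis unfolding s_def[symmetric]
        by (intro bexI[of _ "gz_tl n (v - s)"]) (metis diff_add_cancel)
    qed
  qed
  then show ?thesis by (simp add: V_def K_def X_def n_def)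
qed

text \<open>The gain in dimension depends on the row only, not on the pattern below it, so it comes
  out of the inner sum as a monomial factor.\<close>

theorem f_poly_GZ_recursion:
  assumes "sorted ls" "ls \<noteq> []"
  shows "f_poly (GZ ls) = (\<Sum>r\<in>rep_rows ls. monom 1 (card (set r - set ls)) * f_poly (GZ r))"
proof -
  have "f_poly (GZ ls) = (\<Sum>(r, S) \<in> (SIGMA r : rep_rows ls. gz_tight r ` GZ r).
      monom 1 (dim (gz_lin (length ls) (row_tight ls r \<union> gz_up S))))"
    unfolding f_poly_GZ sum.reindex_bij_betw[OF tight_sets_GZ[OF assms], symmetric]
    by (intro sum.cong) auto
  also have "\<dots> = (\<Sum>r \<in> rep_rows ls. \<Sum>S \<in> gz_tight r ` GZ r.
      monom 1 (dim (gz_lin (length ls) (row_tight ls r \<union> gz_up S))))"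
    by (rule sum.Sigma[symmetric]) (auto simp: finite_rep_rows finite_gz_tight)
  also have "\<dots> = (\<Sum>r\<in>rep_rows ls. monom 1 (card (set r - set ls)) * f_poly (GZ r))"
    unfolding f_poly_GZ sum_distrib_left
    using rep_rows_interlaces[OF assms(1)]
    by (intro sum.cong refl) (auto simp: dim_gz_lin_cons[OF assms(1)] mult_monom add.commute)
  finally show ?thesis .
qed

section \<open>Faces of the cube and monomials\<close>

text \<open>With \<open>m j\<close> for \<open>i j - 1\<close>, the copies of \<open>j\<close> are
  the forced coordinates between equal neighbours, and \<open>c j\<close> fills the slot between the
  last \<open>j\<close> and the first \<open>j + 1\<close>. The choices \<open>real\<close> and
  \<open>\<lambda>j. real j + 1\<close> for \<open>c\<close> give the lower and the upper
  bounds.\<close>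

primrec staircase :: "(nat \<Rightarrow> nat) \<Rightarrow> nat \<Rightarrow> (nat \<Rightarrow> real) \<Rightarrow> real list" where
  "staircase m 0 c = []"
| "staircase m (Suc n) c = staircase m n c @ replicate (m (Suc n)) (real (Suc n)) @ [c (Suc n)]"

definition cube_row :: "(nat \<Rightarrow> nat) \<Rightarrow> nat \<Rightarrow> (nat \<Rightarrow> real) \<Rightarrow> real list" where
  "cube_row m n c = staircase m n c @ replicate (m (Suc n)) (real (Suc n))"

definition face_coords :: "nat \<Rightarrow> real set" where
  "face_coords j = {real j, real j + 1/2, real j + 1}"

lemma staircase_cong: "(\<And>j. 1 \<le> j \<Longrightarrow> j \<le> n \<Longrightarrow> c j = c' j) \<Longrightarrow> staircase m n c = staircase m n c'"
  by (induction n) auto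

lemma length_staircase: "length (staircase m n c) = length (staircase m n c')"
  by (induction n) auto

lemma staircase_inj:
  "staircase m n c = staircase m n c' \<Longrightarrow> 1 \<le> j \<Longrightarrow> j \<le> n \<Longrightarrow> c j = c' j"
proof (induction n)
  case (Suc n)
  then have "staircase m n c = staircase m n c'" "c (Suc n) = c' (Suc n)"
    by (simp_all add: append_eq_append_conv length_staircase[of m n c c'])
  with Suc show ?case by (cases "j = Suc n") auto
qed simp

lemma replicate_Suc_right: "replicate (Suc n) x = replicate n x @ [x]"
  by (simp add: replicate_append_same)

text \<open>The row \<open>1, \<dots>, 1, 2, \<dots>, 2, \<dots>\<close> without its last or its first entry is the least or the greatest
  vertex of the cube of interlacing rows.\<close>

lemma staircase_shift:
  "staircase m n real @ replicate (Suc (m (Suc n))) (real (Suc n)) =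
   1 # staircase m n (\<lambda>j. real j + 1) @ replicate (m (Suc n)) (real (Suc n))"
proof (induction n)
  case (Suc n)
  have "staircase m (Suc n) real = staircase m n real @ replicate (Suc (m (Suc n))) (real (Suc n))"
    by (simp add: replicate_append_same)
  then show ?case unfolding Suc by (simp add: add.commute)
qed simp

lemma list_all2_zip_replicate:
  assumes "\<And>x. Q (a, a) x \<longleftrightarrow> x = a"
  shows "list_all2 Q (zip (replicate n a) (replicate n a)) r \<longleftrightarrow> r = replicate n a"
proof (induction n arbitrary: r)
  case (Suc n)
  then show ?case using assms by (cases r) auto
qed simp

lemma list_all2_append_left_iff:
  "list_all2 Q (xs @ ys) zs \<longleftrightarrow> (\<exists>us vs. zs = us @ vs \<and> list_all2 Q xs us \<and> list_all2 Q ys vs)"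
  by (metis list_all2_append1 list_all2_lengthD)

definition rep_choice :: "real \<times> real \<Rightarrow> real \<Rightarrow> bool" where
  "rep_choice p x \<longleftrightarrow> x \<in> {fst p, (fst p + snd p) / 2, snd p}"

text \<open>Without its last entry \<open>ls\<close> lists the lower bounds of a row, without its
  first entry the upper bounds. In relational form the condition splits along appends, which suits
  the recursion of \<open>staircase\<close>.\<close>

lemma rep_rows_list_all2:
  assumes "ls = A @ [a]" "ls = b # B"
  shows "rep_rows ls = {r. list_all2 rep_choice (zip A B) r}"
proof -
  have len: "length ls = Suc (length A)" "length B = length A"
    using assms by (auto dest: arg_cong[where f = length])
  have "ls ! j = A ! j" "ls ! Suc j = B ! j" if "j < length A" for j
    using that assms by (metis nth_append, metis nth_Cons_Suc)
  then show ?thesis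
    using len by (auto simp: rep_rows_def list_all2_conv_all_nth rep_choice_def)
qed

text \<open>Inside a block the two bounds agree and leave one value; a slot has the bounds
  \<open>j\<close> and \<open>j + 1\<close> and admits the three values of
  \<open>face_coords j\<close>. Functions in \<open>PiE\<close> are fixed outside
  \<open>{1..n}\<close>, so each cube face is one function.\<close>

lemma staircase_rows:
  "list_all2 rep_choice (zip (staircase m n real) (staircase m n (\<lambda>j. real j + 1))) r \<longleftrightarrow>
   r \<in> staircase m n ` (PiE {1..n} face_coords)" (is "?L n r \<longleftrightarrow> ?R n r")
proof (induction n arbitrary: r)
  case (Suc n)
  have "?L (Suc n) r \<longleftrightarrow> (\<exists>us x. r = us @ replicate (m (Suc n)) (real (Suc n)) @ [x] \<and> ?L n us \<and> x \<in> face_coords (Suc n))"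
  proof -
    have zip: "zip (staircase m (Suc n) real) (staircase m (Suc n) (\<lambda>j. real j + 1)) =
      zip (staircase m n real) (staircase m n (\<lambda>j. real j + 1))
      @ zip (replicate (m (Suc n)) (real (Suc n))) (replicate (m (Suc n)) (real (Suc n)))
      @ [(real (Suc n), real (Suc n) + 1)]"
      using length_staircase[of m n real "\<lambda>j. real j + 1"] by simp
    have choice: "rep_choice (real (Suc n), real (Suc n) + 1) x \<longleftrightarrow> x \<in> face_coords (Suc n)" for x
    proof -
      have "(real (Suc n) + (real (Suc n) + 1)) / 2 = real (Suc n) + 1/2" by simp
      then show ?thesis unfolding rep_choice_def face_coords_def fst_conv snd_conv by auto
    qed
    have refl: "rep_choice (a, a) x \<longleftrightarrow> x = a" for a x by (simp add: rep_choice_def)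
    show ?thesis
      unfolding zip list_all2_append_left_iff list_all2_Cons1 list_all2_zip_replicate[of rep_choice, OF refl] choice
      by auto
  qed
  also have "\<dots> \<longleftrightarrow> ?R (Suc n) r"
  proof
    assume "\<exists>us x. r = us @ replicate (m (Suc n)) (real (Suc n)) @ [x] \<and> ?L n us \<and> x \<in> face_coords (Suc n)"
    then obtain c x where *: "r = staircase m n c @ replicate (m (Suc n)) (real (Suc n)) @ [x]"
      "c \<in> PiE {1..n} face_coords" "x \<in> face_coords (Suc n)"
      unfolding Suc by auto
    have "c(Suc n := x) \<in> PiE {1..Suc n} face_coords"
      using *(2,3) by (auto simp: PiE_iff extensional_def)
    moreover have "r = staircase m (Suc n) (c(Suc n := x))"
      using *(1) staircase_cong[of n c "c(Suc n := x)" m] by simp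
    ultimately show "?R (Suc n) r" by blast
  next
    assume "?R (Suc n) r"
    then obtain c where c: "c \<in> PiE {1..Suc n} face_coords" "r = staircase m (Suc n) c" by blast
    then have "restrict c {1..n} \<in> PiE {1..n} face_coords" by auto
    moreover have "staircase m n (restrict c {1..n}) = staircase m n c"
      by (rule staircase_cong) simp
    ultimately have "?L n (staircase m n c)" unfolding Suc by (metis image_eqI)
    with c show "\<exists>us x. r = us @ replicate (m (Suc n)) (real (Suc n)) @ [x] \<and> ?L n us \<and> x \<in> face_coords (Suc n)"
      by auto
  qed
  finally show ?case .
qed simp

lemma cube_row_bij:
  assumes "ls = staircase m n real @ replicate (Suc (m (Suc n))) (real (Suc n))"
  shows "bij_betw (cube_row m n) (PiE {1..n} face_coords) (rep_rows ls)"
  unfolding bij_betw_def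
proof
  show "inj_on (cube_row m n) (PiE {1..n} face_coords)"
  proof (rule inj_onI)
    fix c c' assume *: "c \<in> PiE {1..n} face_coords" "c' \<in> PiE {1..n} face_coords" "cube_row m n c = cube_row m n c'"
    show "c = c'"
      by (rule PiE_ext[OF *(1,2)], rule staircase_inj[of m n]) (use *(3) in \<open>auto simp: cube_row_def\<close>)
  qed
  have ls: "ls = cube_row m n real @ [real (Suc n)]"
    unfolding assms cube_row_def replicate_Suc_right by simp
  have ls': "ls = 1 # cube_row m n (\<lambda>j. real j + 1)"
    unfolding assms staircase_shift cube_row_def ..
  have zip: "zip (cube_row m n real) (cube_row m n (\<lambda>j. real j + 1)) =
    zip (staircase m n real) (staircase m n (\<lambda>j. real j + 1))
    @ zip (replicate (m (Suc n)) (real (Suc n))) (replicate (m (Suc n)) (real (Suc n)))"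
    using length_staircase[of m n real "\<lambda>j. real j + 1"] by (simp add: cube_row_def)
  have refl: "rep_choice (a, a) x \<longleftrightarrow> x = a" for a x by (simp add: rep_choice_def)
  have "rep_rows ls = {us @ replicate (m (Suc n)) (real (Suc n)) | us.
      list_all2 rep_choice (zip (staircase m n real) (staircase m n (\<lambda>j. real j + 1))) us}"
    unfolding rep_rows_list_all2[OF ls ls'] zip list_all2_append_left_iff list_all2_zip_replicate[of rep_choice, OF refl]
    by auto
  also have "\<dots> = cube_row m n ` PiE {1..n} face_coords"
    unfolding staircase_rows cube_row_def by auto
  finally show "cube_row m n ` PiE {1..n} face_coords = rep_rows ls" ..
qed

section \<open>Exponents and new values of a cube face\<close>

lemma real_neq_half: "real a \<noteq> real b + 1/2"
proof
  assume "real a = real b + 1/2"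
  then have "real (2 * a) = real (2 * b + 1)" by simp
  then have "2 * a = 2 * b + 1" unfolding of_nat_eq_iff .
  then show False by presburger
qed

definition face_exponent :: "nat \<Rightarrow> (nat \<Rightarrow> real) \<Rightarrow> exponent" where
  "face_exponent n c = (\<Sum>j = 1..n. Poly_Mapping.single (c j) 1)"

text \<open>Integers are not half-integers, so the variable with index \<open>l + 1/2\<close> comes
  from the \<open>l\<close>-th factor alone. Its exponent is 0 or 1 and tells whether the face is
  free in direction \<open>l\<close>.\<close>

lemma face_coords_half_iff:
  assumes "x \<in> face_coords j"
  shows "x = real l + 1/2 \<longleftrightarrow> j = l \<and> x = real j + 1/2"
  using assms real_neq_half[of j l] real_neq_half[of "Suc j" l] by (auto simp: face_coords_def)

lemma dim_A_face_exponent: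
  assumes "c \<in> PiE {1..n} face_coords"
  shows "dim_A (Suc n) (face_exponent n c) = card {j \<in> {1..n}. c j = real j + 1/2}"
proof -
  have "Poly_Mapping.lookup (face_exponent n c) (real l + 1/2) = of_bool (c l = real l + 1/2)"
    if "l \<in> {1..n}" for l
  proof -
    have "Poly_Mapping.lookup (face_exponent n c) (real l + 1/2) = (\<Sum>j = 1..n. of_bool (c j = real l + 1/2))"
      unfolding face_exponent_def lookup_sum by (intro sum.cong) (auto simp: lookup_single when_def)
    also have "\<dots> = (\<Sum>j = 1..n. if j = l then of_bool (c l = real l + 1/2) else 0)"
      using assms by (intro sum.cong refl) (subst face_coords_half_iff, auto)
    also have "\<dots> = of_bool (c l = real l + 1/2)" using that by simp
    finally show ?thesis .
  qed
  then have "dim_A (Suc n) (face_exponent n c) = (\<Sum>l = 1..n. of_bool (c l = real l + 1/2))"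
    unfolding dim_A_def by (intro sum.cong) auto
  also have "\<dots> = card {j \<in> {1..n}. c j = real j + 1/2}"
    by (simp add: sum.If_cases of_bool_def Int_def)
  finally show ?thesis .
qed

lemma set_staircase: "set (staircase m n c) = {real j | j. 1 \<le> j \<and> j \<le> n \<and> m j > 0} \<union> c ` {1..n}"
proof (induction n)
  case (Suc n)
  have "{1..Suc n} = insert (Suc n) {1..n}" by auto
  then show ?case using Suc by (auto simp: le_Suc_eq simp del: of_nat_Suc)
qed auto

text \<open>Every integer from 1 to \<open>n + 1\<close> occurs in \<open>ls\<close>, even where
  \<open>m j = 0\<close>, so the new values are the half-integers of the row. They differ for
  different \<open>j\<close>.\<close>

lemma new_values_cube_row:
  assumes c: "c \<in> PiE {1..n} face_coords"
    and ls: "ls = staircase m n real @ replicate (Suc (m (Suc n))) (real (Suc n))"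
  shows "card (set (cube_row m n c) - set ls) = card {j \<in> {1..n}. c j = real j + 1/2}"
proof -
  have set_ls: "set ls = real ` {1..Suc n}"
    unfolding ls set_append set_staircase by (auto simp: le_Suc_eq image_iff simp del: of_nat_Suc)
  have "set (cube_row m n c) - set ls = c ` {1..n} - real ` {1..Suc n}"
    unfolding set_ls cube_row_def set_append set_staircase by (auto simp: set_replicate_conv_if simp del: of_nat_Suc)
  also have "\<dots> = (\<lambda>j. real j + 1/2) ` {j \<in> {1..n}. c j = real j + 1/2}"
  proof (intro subset_antisym subsetI)
    fix x assume x: "x \<in> c ` {1..n} - real ` {1..Suc n}"
    then obtain j where j: "j \<in> {1..n}" "x = c j" by blast
    then have "c j \<in> face_coords j" using c by auto
    moreover have "real j \<in> real ` {1..Suc n}" "real (Suc j) \<in> real ` {1..Suc n}"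
      using j(1) by (intro imageI; simp)+
    then have "c j \<noteq> real j" "c j \<noteq> real j + 1"
      using x j(2) by (auto simp: add.commute)
    ultimately show "x \<in> (\<lambda>j. real j + 1/2) ` {j \<in> {1..n}. c j = real j + 1/2}"
      using j by (auto simp: face_coords_def)
  next
    fix x assume "x \<in> (\<lambda>j. real j + 1/2) ` {j \<in> {1..n}. c j = real j + 1/2}"
    then obtain j where j: "j \<in> {1..n}" "c j = real j + 1/2" "x = real j + 1/2" by blast
    then have "x \<in> c ` {1..n}" by (metis imageI)
    moreover have "x \<notin> real ` {1..Suc n}" using j(3) real_neq_half by (metis imageE)
    ultimately show "x \<in> c ` {1..n} - real ` {1..Suc n}" by blast
  qed
  also have "card \<dots> = card {j \<in> {1..n}. c j = real j + 1/2}"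
    by (rule card_image) (auto simp: inj_on_def)
  finally show ?thesis .
qed

lemma cube_poly_expand:
  "cube_poly (Suc n) = (\<Sum>c \<in> PiE {1..n} face_coords. Poly_Mapping.single (face_exponent n c) 1)"
proof -
  have "cube_poly (Suc n) = (\<Prod>j = 1..n. \<Sum>y\<in>face_coords j. xvar y)"
    unfolding cube_poly_def by (intro prod.cong) (auto simp: face_coords_def add.assoc)
  also have "\<dots> = (\<Sum>c \<in> PiE {1..n} face_coords. \<Prod>j = 1..n. xvar (c j))"
    by (rule prod_sum_PiE) (auto simp: face_coords_def)
  also have "\<dots> = (\<Sum>c \<in> PiE {1..n} face_coords. Poly_Mapping.single (face_exponent n c) 1)"
  proof (rule sum.cong[OF refl])
    fix c :: "nat \<Rightarrow> real"
    show "(\<Prod>j = 1..n. xvar (c j)) = Poly_Mapping.single (face_exponent n c) 1"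
      unfolding face_exponent_def
      by (induction n) (simp_all add: xvar_def mult_single flip: single_one)
  qed
  finally show ?thesis .
qed

text \<open>The coefficient of \<open>\<alpha>\<close> counts the \<open>c\<close> with
  \<open>a c = \<alpha>\<close>, and each summand depends on \<open>c\<close> only through
  \<open>a c\<close>; collecting equal monomials therefore preserves the sum.\<close>

lemma sum_keys_sum_single:
  fixes G :: "'b \<Rightarrow> int poly" and a :: "'c \<Rightarrow> 'b" and C :: "'c set"
  assumes "finite C"
  defines "p \<equiv> \<Sum>c\<in>C. Poly_Mapping.single (a c) (1::int)"
  shows "(\<Sum>\<alpha>\<in>Poly_Mapping.keys p. monom (Poly_Mapping.lookup p \<alpha>) (d \<alpha>) * G \<alpha>)
    = (\<Sum>c\<in>C. monom 1 (d (a c)) * G (a c))"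
proof -
  have lookup: "Poly_Mapping.lookup p \<alpha> = (\<Sum>c\<in>C. if a c = \<alpha> then 1 else 0)" for \<alpha>
    unfolding p_def lookup_sum by (intro sum.cong) (auto simp: lookup_single when_def)
  have "Poly_Mapping.keys p \<subseteq> a ` C"
  proof
    fix \<alpha> assume "\<alpha> \<in> Poly_Mapping.keys p"
    then have "(\<Sum>c\<in>C. if a c = \<alpha> then 1 else 0 :: int) \<noteq> 0" by (simp add: in_keys_iff lookup)
    moreover have "(\<Sum>c\<in>C. if a c = \<alpha> then 1 else 0 :: int) = 0" if "\<alpha> \<notin> a ` C"
      using that by (intro sum.neutral) auto
    ultimately show "\<alpha> \<in> a ` C" by blast
  qed
  then have "(\<Sum>\<alpha>\<in>Poly_Mapping.keys p. monom (Poly_Mapping.lookup p \<alpha>) (d \<alpha>) * G \<alpha>)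
      = (\<Sum>\<alpha>\<in>a ` C. monom (Poly_Mapping.lookup p \<alpha>) (d \<alpha>) * G \<alpha>)"
    using assms(1) by (intro sum.mono_neutral_left) (auto simp: in_keys_iff)
  also have "\<dots> = (\<Sum>\<alpha>\<in>a ` C. \<Sum>c\<in>C. if a c = \<alpha> then monom 1 (d \<alpha>) * G \<alpha> else 0)"
  proof (rule sum.cong[OF refl])
    fix \<alpha>
    have "monom (Poly_Mapping.lookup p \<alpha>) (d \<alpha>) = (\<Sum>c\<in>C. if a c = \<alpha> then monom 1 (d \<alpha>) else 0)"
      unfolding lookup by (subst monom_sum) (intro sum.cong refl, simp)
    then show "monom (Poly_Mapping.lookup p \<alpha>) (d \<alpha>) * G \<alpha>
        = (\<Sum>c\<in>C. if a c = \<alpha> then monom 1 (d \<alpha>) * G \<alpha> else 0)"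
      by (simp add: sum_distrib_right if_distrib[of "\<lambda>x. x * _"] cong: if_cong)
  qed
  also have "\<dots> = (\<Sum>c\<in>C. \<Sum>\<alpha>\<in>a ` C. if a c = \<alpha> then monom 1 (d \<alpha>) * G \<alpha> else 0)"
    by (rule sum.swap)
  also have "\<dots> = (\<Sum>c\<in>C. monom 1 (d (a c)) * G (a c))"
    using assms(1) by (intro sum.cong refl) simp
  finally show ?thesis .
qed

section \<open>Recovering a barycenter row from its exponent\<close>

primrec alpha_list :: "(nat \<Rightarrow> nat) \<Rightarrow> exponent \<Rightarrow> nat \<Rightarrow> real list" where
  "alpha_list m \<beta> 0 = []"
| "alpha_list m \<beta> (Suc n) = alpha_list m \<beta> n
     @ replicate (m (Suc n) + Poly_Mapping.lookup \<beta> (real (Suc n))) (real (Suc n))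
     @ replicate (Poly_Mapping.lookup \<beta> (real (Suc n) + 1/2)) (real (Suc n) + 1/2)"

lemma GZ_alpha_list:
  "GZ_alpha (Suc n) i \<alpha> = GZ (alpha_list (\<lambda>j. i j - 1) \<alpha> n
     @ replicate (i (Suc n) - 1 + Poly_Mapping.lookup \<alpha> (real (Suc n))) (real (Suc n)))"
proof -
  have "concat (map (\<lambda>(a, m). replicate m a)
     (concat (map (\<lambda>j. [(real j, i j - 1 + Poly_Mapping.lookup \<alpha> (real j)),
                        (real j + 1/2, Poly_Mapping.lookup \<alpha> (real j + 1/2))]) [1..<Suc n])))
    = alpha_list (\<lambda>j. i j - 1) \<alpha> n"
    by (induction n) auto
  then show ?thesis unfolding GZ_alpha_def GZ_mult_def by simp
qed

lemma sorted_alpha_list: "sorted (alpha_list m \<beta> n) \<and> set (alpha_list m \<beta> n) \<subseteq> {..real n + 1/2}"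
proof (induction n)
  case (Suc n)
  then have "sorted (alpha_list m \<beta> n)" "\<And>x. x \<in> set (alpha_list m \<beta> n) \<Longrightarrow> x \<le> real n + 1/2" by auto
  then show ?case by (force simp: sorted_append)
qed simp

lemma sorted_staircase:
  assumes "\<And>j. 1 \<le> j \<Longrightarrow> j \<le> n \<Longrightarrow> c j \<in> face_coords j"
  shows "sorted (staircase m n c) \<and> set (staircase m n c) \<subseteq> {..real n + 1}"
  using assms
proof (induction n)
  case (Suc n)
  then have IH: "sorted (staircase m n c)" "\<And>x. x \<in> set (staircase m n c) \<Longrightarrow> x \<le> real n + 1" by auto
  have "real (Suc n) \<le> c (Suc n)" "c (Suc n) \<le> real (Suc n) + 1"
    using Suc.prems[of "Suc n"] by (auto simp: face_coords_def)
  then show ?case using IH by (force simp: sorted_append)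
qed simp

text \<open>The monomial read as the multiset of its indices, summed over the finitely many indices
  that can occur.\<close>

definition exponent_mset :: "nat \<Rightarrow> exponent \<Rightarrow> real multiset" where
  "exponent_mset n \<beta> = (\<Sum>y \<in> real ` {1..Suc n} \<union> (\<lambda>j. real j + 1/2) ` {1..n}.
     replicate_mset (Poly_Mapping.lookup \<beta> y) y)"

text \<open>Both sides are additive over the factors, so a single factor suffices; there
  \<open>c j\<close> has to lie in the range of summation.\<close>

lemma exponent_mset_face:
  assumes "c \<in> PiE {1..n} face_coords"
  shows "exponent_mset n (face_exponent n c) = (\<Sum>j = 1..n. {#c j#})"
proof -
  define S where "S = real ` {1..Suc n} \<union> (\<lambda>j. real j + 1/2) ` {1..n}"
  have single: "(\<Sum>y\<in>S. replicate_mset (Poly_Mapping.lookup (Poly_Mapping.single (c j) 1) y) y) = {#c j#}"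
    if "j \<in> {1..n}" for j
  proof -
    have "c j \<in> face_coords j" using assms that by auto
    moreover have "real j \<in> real ` {1..Suc n}" "real j + 1 \<in> real ` {1..Suc n}"
      using that by (auto simp: image_iff intro!: bexI[of _ "Suc j"])
    ultimately have "c j \<in> S"
      using that by (auto simp: S_def face_coords_def)
    have "(\<Sum>y\<in>S. replicate_mset (Poly_Mapping.lookup (Poly_Mapping.single (c j) 1) y) y)
       = (\<Sum>y\<in>S. if c j = y then {#c j#} else {#})"
      by (intro sum.cong) (auto simp: lookup_single when_def)
    also have "\<dots> = {#c j#}" using \<open>c j \<in> S\<close> by (simp add: S_def)
    finally show ?thesis .
  qed
  have "(\<Sum>y\<in>S. replicate_mset (Poly_Mapping.lookup (\<Sum>j\<in>J. Poly_Mapping.single (c j) 1) y) y) = (\<Sum>j\<in>J. {#c j#})"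
    if "finite J" "J \<subseteq> {1..n}" for J
    using that
  proof (induction J rule: finite_induct)
    case (insert j J)
    have "(\<Sum>y\<in>S. replicate_mset (Poly_Mapping.lookup (\<Sum>j\<in>insert j J. Poly_Mapping.single (c j) 1) y) y)
      = (\<Sum>y\<in>S. replicate_mset (Poly_Mapping.lookup (Poly_Mapping.single (c j) 1) y) y
           + replicate_mset (Poly_Mapping.lookup (\<Sum>j\<in>J. Poly_Mapping.single (c j) 1) y) y)"
      using insert.hyps by (intro sum.cong refl) (auto simp: lookup_add multiset_eq_iff)
    also have "\<dots> = {#c j#} + (\<Sum>j\<in>J. {#c j#})"
      unfolding sum.distrib using single[of j] insert.prems insert.IH by simp
    finally show ?case using insert.hyps by simp
  qed simp
  from this[of "{1..n}"] show ?thesis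
    by (simp add: exponent_mset_def face_exponent_def S_def)
qed

lemma exponent_mset_split:
  "exponent_mset n \<beta> = (\<Sum>j = 1..Suc n. replicate_mset (Poly_Mapping.lookup \<beta> (real j)) (real j))
    + (\<Sum>j = 1..n. replicate_mset (Poly_Mapping.lookup \<beta> (real j + 1/2)) (real j + 1/2))"
proof -
  have "real ` {1..Suc n} \<inter> (\<lambda>j. real j + 1/2) ` {1..n} = {}"
    using real_neq_half by blast
  then show ?thesis
    unfolding exponent_mset_def
    by (subst sum.union_disjoint) (simp_all add: sum.reindex inj_on_def del: sum.cl_ivl_Suc)
qed

lemma mset_alpha_list:
  "mset (alpha_list m \<beta> n @ replicate (m (Suc n) + Poly_Mapping.lookup \<beta> (real (Suc n))) (real (Suc n)))
    = (\<Sum>j = 1..Suc n. replicate_mset (m j) (real j)) + exponent_mset n \<beta>"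
proof -
  have "replicate_mset (a + b) x = replicate_mset a x + replicate_mset b x" for a b and x :: real
    by (simp add: multiset_eq_iff)
  then show ?thesis
    unfolding exponent_mset_split by (induction n) (simp_all add: ac_simps)
qed

lemma mset_cube_row:
  "mset (cube_row m n c) = (\<Sum>j = 1..Suc n. replicate_mset (m j) (real j)) + (\<Sum>j = 1..n. {#c j#})"
  unfolding cube_row_def by (induction n) (simp_all add: ac_simps)

text \<open>Both lists are sorted and have the same multiset of entries, so they are equal, although
  the cube row depends on \<open>c\<close> and the other list only on its exponent.\<close>

lemma GZ_alpha_face:
  assumes "c \<in> PiE {1..n} face_coords"
  shows "GZ_alpha (Suc n) i (face_exponent n c) = GZ (cube_row (\<lambda>j. i j - 1) n c)"
proof -
  define m where "m = (\<lambda>j. i j - 1)"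
  define \<beta> where "\<beta> = face_exponent n c"
  let ?L = "alpha_list m \<beta> n @ replicate (m (Suc n) + Poly_Mapping.lookup \<beta> (real (Suc n))) (real (Suc n))"
  have "sorted ?L"
    using sorted_alpha_list[of m \<beta> n] by (force simp: sorted_append)
  moreover have "sorted (cube_row m n c)"
    using sorted_staircase[of n c m] assms by (force simp: cube_row_def sorted_append)
  moreover have "mset ?L = mset (cube_row m n c)"
    unfolding mset_alpha_list mset_cube_row \<beta>_def exponent_mset_face[OF assms] ..
  ultimately have "?L = cube_row m n c"
    by (metis properties_for_sort)
  then show ?thesis unfolding GZ_alpha_list by (simp add: m_def \<beta>_def)
qed

theorem mainTheorem1:
  fixes k :: nat and i :: "nat \<Rightarrow> nat"
  assumes "k \<ge> 1" and "\<And>j. 1 \<le> j \<Longrightarrow> j \<le> k \<Longrightarrow> i j \<ge> 1"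
  shows "f_poly (GZ_mult (map (\<lambda>j. (real j, i j)) [1..<k + 1])) =
    (\<Sum>\<alpha> \<in> Poly_Mapping.keys (cube_poly k).
       monom (Poly_Mapping.lookup (cube_poly k) \<alpha>) (dim_A k \<alpha>) * f_poly (GZ_alpha k i \<alpha>))"
proof -
  obtain n where k: "k = Suc n" using assms(1) by (cases k) auto
  define m where "m = (\<lambda>j. i j - 1)"
  \<comment> \<open>As \<open>i j >= 1\<close>, the \<open>i j\<close> copies of \<open>j\<close>
    are \<open>m j\<close> copies and one more; for \<open>j <= n\<close> the extra copy is the slot
    entry \<open>c j\<close> with \<open>c = real\<close>.\<close>
  define ls where "ls = staircase m n real @ replicate (Suc (m (Suc n))) (real (Suc n))"
  define C where "C = PiE {1..n} face_coords"
  have "concat (map (\<lambda>j. replicate (i j) (real j)) [1..<Suc l]) = staircase m l real" if "l \<le> n" for l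
    using that
  proof (induction l)
    case (Suc l)
    have "i (Suc l) = Suc (m (Suc l))" using assms(2)[of "Suc l"] Suc.prems k by (simp add: m_def)
    then have "replicate (i (Suc l)) (real (Suc l)) = replicate (m (Suc l)) (real (Suc l)) @ [real (Suc l)]"
      by (simp only: replicate_Suc_right)
    then show ?case using Suc by simp
  qed simp
  from this[of n] have stairs: "concat (map (\<lambda>j. replicate (i j) (real j)) [1..<Suc n]) = staircase m n real" by simp
  have "i (Suc n) = Suc (m (Suc n))" using assms(2)[of "Suc n"] k by (simp add: m_def)
  with stairs have "concat (map (\<lambda>j. replicate (i j) (real j)) [1..<k + 1]) = ls"
    by (simp add: k ls_def)
  then have GZ_ls: "GZ_mult (map (\<lambda>j. (real j, i j)) [1..<k + 1]) = GZ ls"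
    by (simp add: GZ_mult_def comp_def)
  have "sorted ls"
    using sorted_staircase[of n real m] by (force simp: ls_def sorted_append face_coords_def simp del: replicate_Suc)
  then have "f_poly (GZ ls) = (\<Sum>r\<in>rep_rows ls. monom 1 (card (set r - set ls)) * f_poly (GZ r))"
    by (rule f_poly_GZ_recursion) (simp add: ls_def)
  also have "\<dots> = (\<Sum>c\<in>C. monom 1 (card (set (cube_row m n c) - set ls)) * f_poly (GZ (cube_row m n c)))"
    unfolding C_def by (rule sum.reindex_bij_betw[OF cube_row_bij[OF ls_def], symmetric])
  also have "\<dots> = (\<Sum>c\<in>C. monom 1 (dim_A k (face_exponent n c)) * f_poly (GZ_alpha k i (face_exponent n c)))"
    unfolding C_def k m_def
    by (intro sum.cong refl)
      (simp only: GZ_alpha_face dim_A_face_exponent new_values_cube_row[OF _ ls_def, unfolded m_def])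
  also have "\<dots> = (\<Sum>\<alpha> \<in> Poly_Mapping.keys (cube_poly k).
       monom (Poly_Mapping.lookup (cube_poly k) \<alpha>) (dim_A k \<alpha>) * f_poly (GZ_alpha k i \<alpha>))"
    unfolding k cube_poly_expand C_def[symmetric]
    by (rule sum_keys_sum_single[symmetric]) (auto simp: C_def face_coords_def intro: finite_PiE)
  finally show ?thesis unfolding GZ_ls .
qed

end
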